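(* Let $\mathcal{M}$ be a countable (finite or infinite) class of probability measures on the sequence space $(\Omega,\mathcal{F})$, $\Omega=\mathcal{X}^\infty$, and let $P\in\mathcal{M}$ (the true sampling distribution). No further assumptions (such as independence, ergodicity, stationarity, or identifiability) are made on $\mathcal{M}$. Let $K:\mathcal{M}\to\mathbb{R}$ satisfy $\sum_{Q\in\mathcal{M}}2^{-K(Q)}<\infty$. For $\ell\ge 0$ and $x=x_{1:\ell}\in\mathcal{X}^\ell$ let $$\mathrm{MDL}^x:=\arg\min_{Q\in\mathcal{M}}\{-\log_2 Q(x)+K(Q)\}\in\mathcal{M}.$$ Then for $P$-almost every $\omega\in\Omega$, with $x=\omega_{1:\ell}$, $$\sup_{A\in\mathcal{F}}\bigl|\mathrm{MDL}^x[A|x]-P[A|x]\bigr|\;\longrightarrow\;0\qquad\text{as }\ell\to\infty .$$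
   Context: Let $(\mathcal{X}_t,\mathcal{B}_t)$, $t=1,2,\dots$, be arbitrary measurable spaces (e.g. all equal to one space $\mathcal{X}$), $\mathcal{X}^\ell:=\mathcal{X}_1\times\dots\times\mathcal{X}_\ell$ with product $\sigma$-field $\mathcal{F}_\ell$ for $\ell\le\infty$, $\Omega:=\mathcal{X}^\infty$, $\mathcal{F}:=\mathcal{F}_\infty$. For $\omega\in\Omega$, $\omega_{1:\ell}\in\mathcal{X}^\ell$ denotes its first $\ell$ coordinates. For a probability measure $Q$ on $(\Omega,\mathcal{F})$, $Q_\ell$ denotes its marginal on $(\mathcal{X}^\ell,\mathcal{F}_\ell)$. Square brackets denote measures of events, round brackets denote densities of finite strings. Countable $\mathcal{X}$: $Q(x):=Q[\{x\}\times\mathcal{X}^\infty]$ for $x\in\mathcal{X}^\ell$, and $Q[A|x]:=Q[A\cap(\{x\}\times\mathcal{X}^\infty)]/Q(x)$ whenever $Q(x)>0$. General $\mathcal{X}$: fix a measure $M$ on $(\Omega,\mathcal{F})$ with $\sigma$-finite marginals such that $Q\ll M$ for all $Q\in\mathcal{M}$ (for instance $M=\sum_{Q\in\mathcal{M}}w_Q Q$ with $w_Q>0$, $\sum_Q w_Q=1$); then $Q(x):=\frac{dQ_\ell}{dM_\ell}(x)$ for $x\in\mathcal{X}^\ell$ (the choice of $M$ is immaterial). The predictive distribution $Q[\cdot|x]$, $x\in\mathcal{X}^\ell$, is a version of the regular conditional distribution of $Q$ given the first $\ell$ coordinates, i.e. $\int_B Q[A|x]\,dQ_\ell(x)=Q[A\cap\{\omega:\omega_{1:\ell}\in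 B\}]$ for all $A\in\mathcal{F}$, $B\in\mathcal{F}_\ell$. Such versions are assumed to exist and, when they are not almost surely unique, to be suitably (consistently) chosen for the different $Q\in\mathcal{M}$, e.g. all obtained from one regular conditional distribution of the mixture $M$ and the densities $dQ/dM$. $-\log_2 0:=+\infty$. $P$-almost surely the minimum defining $\mathrm{MDL}^x$ is attained and finite for all $\ell$; ties are broken arbitrarily, and on the exceptional $P$-null set $\mathrm{MDL}^x$ is arbitrary. $\mathrm{MDL}^x[A|x]$ denotes $Q[A|x]$ for the selected $Q=\mathrm{MDL}^x$. *)

theory Defs
  imports "HOL-Probability.Probability"
begin

text \<open>
  The coordinate spaces \<open>X 0, X 1, \<dots>\<close> share one carrier type but may have different underlying sets
  and \<open>\<sigma>\<close>-fields. A string of length \<open>l\<close> is an extensional function on \<open>{..<l}\<close>.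
\<close>

abbreviation seq_space :: "(nat \<Rightarrow> 'a measure) \<Rightarrow> (nat \<Rightarrow> 'a) measure" where
  "seq_space X \<equiv> PiM UNIV X"

abbreviation string_space :: "(nat \<Rightarrow> 'a measure) \<Rightarrow> nat \<Rightarrow> (nat \<Rightarrow> 'a) measure" where
  "string_space X l \<equiv> PiM {..<l} X"

abbreviation initial :: "nat \<Rightarrow> (nat \<Rightarrow> 'a) \<Rightarrow> (nat \<Rightarrow> 'a)" where
  "initial l \<omega> \<equiv> restrict \<omega> {..<l}"

definition marginal ::
    "(nat \<Rightarrow> 'a measure) \<Rightarrow> nat \<Rightarrow> (nat \<Rightarrow> 'a) measure \<Rightarrow> (nat \<Rightarrow> 'a) measure" where
  "marginal X l Q = distr Q (string_space X l) (initial l)"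

text \<open>
  The value \<open>q Q l x\<close> is \<open>Q(x)\<close> for a string \<open>x\<close> of length \<open>l\<close>. There are two conventions: the
  probability of the cylinder of \<open>x\<close> if all coordinate spaces are countable and discrete, and in
  general arbitrary versions of the densities of the marginals with respect to those of a common
  reference measure \<open>M\<close>.
\<close>

definition point_probabilities ::
    "(nat \<Rightarrow> 'a measure) \<Rightarrow> (nat \<Rightarrow> 'a) measure set \<Rightarrow>
     ((nat \<Rightarrow> 'a) measure \<Rightarrow> nat \<Rightarrow> (nat \<Rightarrow> 'a) \<Rightarrow> ennreal) \<Rightarrow> bool" where
  "point_probabilities X \<M> q \<longleftrightarrow>
     (\<forall>t. countable (space (X t)) \<and> sets (X t) = Pow (space (X t))) \<and>
     (\<forall>Q\<in>\<M>. \<forall>l. \<forall>x\<in>space (string_space X l).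
        q Q l x = emeasure Q {\<omega>\<in>space (seq_space X). initial l \<omega> = x})"

text \<open>
  The conditions on densities are imposed for \<open>l > 0\<close> only: as the space of strings of length \<open>0\<close> has
  one point, \<open>\<sigma>\<close>-finiteness of the marginal at \<open>l = 0\<close> would force \<open>M\<close> to be finite.
\<close>

definition densities_wrt ::
    "(nat \<Rightarrow> 'a measure) \<Rightarrow> (nat \<Rightarrow> 'a) measure set \<Rightarrow> (nat \<Rightarrow> 'a) measure \<Rightarrow>
     ((nat \<Rightarrow> 'a) measure \<Rightarrow> nat \<Rightarrow> (nat \<Rightarrow> 'a) \<Rightarrow> ennreal) \<Rightarrow> bool" where
  "densities_wrt X \<M> M q \<longleftrightarrow>
     sets M = sets (seq_space X) \<and>
     (\<forall>l>0. sigma_finite_measure (marginal X l M)) \<and>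
     (\<forall>Q\<in>\<M>. absolutely_continuous M Q) \<and>
     (\<forall>Q\<in>\<M>. \<forall>l>0. q Q l \<in> borel_measurable (string_space X l) \<and>
        density (marginal X l M) (q Q l) = marginal X l Q)"

definition string_densities ::
    "(nat \<Rightarrow> 'a measure) \<Rightarrow> (nat \<Rightarrow> 'a) measure set \<Rightarrow>
     ((nat \<Rightarrow> 'a) measure \<Rightarrow> nat \<Rightarrow> (nat \<Rightarrow> 'a) \<Rightarrow> ennreal) \<Rightarrow> bool" where
  "string_densities X \<M> q \<longleftrightarrow> point_probabilities X \<M> q \<or> (\<exists>M. densities_wrt X \<M> M q)"

text \<open>
  Here \<open>k x\<close> is the measure \<open>Q[\<cdot> | x]\<close>. Measurability into \<open>prob_algebra\<close> says that \<open>k\<close> is a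
  probability kernel.
\<close>

definition regular_conditional ::
    "(nat \<Rightarrow> 'a measure) \<Rightarrow> (nat \<Rightarrow> 'a) measure \<Rightarrow> nat \<Rightarrow>
     ((nat \<Rightarrow> 'a) \<Rightarrow> (nat \<Rightarrow> 'a) measure) \<Rightarrow> bool" where
  "regular_conditional X Q l k \<longleftrightarrow>
     k \<in> measurable (string_space X l) (prob_algebra (seq_space X)) \<and>
     (\<forall>A\<in>sets (seq_space X). \<forall>B\<in>sets (string_space X l).
        (\<integral>\<^sup>+x\<in>B. emeasure (k x) A \<partial>marginal X l Q) =
          emeasure Q (A \<inter> {\<omega>\<in>space (seq_space X). initial l \<omega> \<in> B}))"

definition as_unique_conditional ::
    "(nat \<Rightarrow> 'a measure) \<Rightarrow> (nat \<Rightarrow> 'a) measure \<Rightarrow> nat \<Rightarrow> bool" where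
  "as_unique_conditional X Q l \<longleftrightarrow>
     (\<forall>k k'. regular_conditional X Q l k \<longrightarrow> regular_conditional X Q l k' \<longrightarrow>
        (AE x in marginal X l Q. k x = k' x))"

text \<open>
  Consistency: up to null sets, all versions arise from regular conditional distributions \<open>k l\<close> of
  one dominating probability measure \<open>N\<close> (for instance a mixture of the class) and densities \<open>f Q\<close>
  of \<open>Q\<close> with respect to \<open>N\<close> on the whole sequence space, by the formula
  \<open>Q[A | x] = (\<integral>\<^sub>A f Q dN[\<cdot> | x]) / (\<integral> f Q dN[\<cdot> | x])\<close>.
\<close>

definition consistent_conditionals ::
    "(nat \<Rightarrow> 'a measure) \<Rightarrow> (nat \<Rightarrow> 'a) measure set \<Rightarrow>
     ((nat \<Rightarrow> 'a) measure \<Rightarrow> nat \<Rightarrow> (nat \<Rightarrow> 'a) \<Rightarrow> (nat \<Rightarrow> 'a) measure) \<Rightarrow> bool" where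
  "consistent_conditionals X \<M> C \<longleftrightarrow>
     (\<exists>N k f. prob_space N \<and> sets N = sets (seq_space X) \<and>
        (\<forall>l. regular_conditional X N l (k l)) \<and>
        (\<forall>Q\<in>\<M>. f Q \<in> borel_measurable (seq_space X) \<and> density N (f Q) = Q) \<and>
        (\<forall>Q\<in>\<M>. \<forall>l. AE x in marginal X l Q.
           C Q l x = density (k l x) (\<lambda>\<omega>. f Q \<omega> / (\<integral>\<^sup>+\<omega>'. f Q \<omega>' \<partial>k l x))))"

definition predictive_distributions ::
    "(nat \<Rightarrow> 'a measure) \<Rightarrow> (nat \<Rightarrow> 'a) measure set \<Rightarrow>
     ((nat \<Rightarrow> 'a) measure \<Rightarrow> nat \<Rightarrow> (nat \<Rightarrow> 'a) \<Rightarrow> (nat \<Rightarrow> 'a) measure) \<Rightarrow> bool" where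
  "predictive_distributions X \<M> C \<longleftrightarrow>
     (\<forall>Q\<in>\<M>. \<forall>l. regular_conditional X Q l (C Q l)) \<and>
     ((\<forall>Q\<in>\<M>. \<forall>l. as_unique_conditional X Q l) \<or> consistent_conditionals X \<M> C)"

definition neg_log2 :: "ennreal \<Rightarrow> ereal" where
  "neg_log2 p = (if p = 0 then \<infinity> else if p = \<top> then - \<infinity> else ereal (- log 2 (enn2real p)))"

definition code_length ::
    "((nat \<Rightarrow> 'a) measure \<Rightarrow> nat \<Rightarrow> (nat \<Rightarrow> 'a) \<Rightarrow> ennreal) \<Rightarrow> ((nat \<Rightarrow> 'a) measure \<Rightarrow> real) \<Rightarrow>
     nat \<Rightarrow> (nat \<Rightarrow> 'a) \<Rightarrow> (nat \<Rightarrow> 'a) measure \<Rightarrow> ereal" where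
  "code_length q K l x Q = neg_log2 (q Q l x) + ereal (K Q)"

text \<open>
  Ties are broken arbitrarily, and nothing is required of \<open>MDL l x\<close> where the minimum is not attained.
\<close>

definition MDL_selector ::
    "(nat \<Rightarrow> 'a measure) \<Rightarrow> (nat \<Rightarrow> 'a) measure set \<Rightarrow>
     ((nat \<Rightarrow> 'a) measure \<Rightarrow> nat \<Rightarrow> (nat \<Rightarrow> 'a) \<Rightarrow> ennreal) \<Rightarrow> ((nat \<Rightarrow> 'a) measure \<Rightarrow> real) \<Rightarrow>
     (nat \<Rightarrow> (nat \<Rightarrow> 'a) \<Rightarrow> (nat \<Rightarrow> 'a) measure) \<Rightarrow> bool" where
  "MDL_selector X \<M> q K MDL \<longleftrightarrow>
     (\<forall>l. \<forall>x\<in>space (string_space X l).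
        (\<exists>Q. is_arg_min (code_length q K l x) (\<lambda>Q. Q \<in> \<M>) Q) \<longrightarrow>
        is_arg_min (code_length q K l x) (\<lambda>Q. Q \<in> \<M>) (MDL l x))"

end

theory Submission
  imports Defs
begin

text \<open>
  Say that \<open>Q\<close> beats \<open>P\<close> at \<open>x\<close> if \<open>2 powr (K Q - K P) * P(x) \<le> Q(x)\<close>; the selected model always beats \<open>P\<close>. By
  Ville's inequality \<open>Q\<close> ever beats \<open>P\<close> with \<open>P\<close>-probability at most \<open>2 powr (K P - K Q)\<close>, so by Borel--Cantelli
  almost surely only finitely many models are ever selected. A model that beats \<open>P\<close> infinitely often
  has a likelihood ratio bounded away from zero in the limit, and there the predictions of \<open>Q\<close> and
  \<open>P\<close> merge (Blackwell--Dubins): writing both as densities \<open>f\<close> with respect to a common \<open>N\<close> with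
  conditional distributions \<open>k\<close>, almost every \<open>\<omega>\<close> satisfies
  \<open>\<integral> \<bar>f - f(\<omega>)\<bar> dk(initial l \<omega>) \<longlonglongrightarrow> 0\<close>, so both normalised densities become constant in the limit and
  both predictions approach \<open>k\<close>.
\<close>

subsection \<open>Cylinders and regular conditional distributions\<close>

text \<open>Two unrelated kinds of density occur: the string values \<open>q\<close>, taken against
  an arbitrary reference, and the densities \<open>f\<close> against the probability
  \<open>N\<close> behind the conditional distributions. They meet only in \<open>c * emeasure P
  (cylinder X l D) \<le> emeasure Q (cylinder X l D)\<close>, for sets \<open>D\<close> of strings
  at which \<open>Q\<close> beats \<open>P\<close>. This mentions no density, and both the maximal
  inequality and the merging argument take it as their hypothesis. The predictions of
  \<open>Q\<close> are controlled only up to \<open>Q\<close>-null sets, whereas the claim concerns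
  \<open>P\<close>. Where \<open>Q\<close> beats \<open>P\<close> infinitely often, positivity of
  the density of \<open>P\<close> forces positivity of that of \<open>Q\<close>, so the
  \<open>Q\<close>-null sets do no harm there. On arbitrary measurable spaces a dominating measure
  need not have regular conditional distributions. If the given versions are almost surely unique,
  those of the mixture of \<open>P\<close> and \<open>Q\<close> are assembled from them by posterior
  weights. One pair at a time suffices, as the class is countable. The minimum is attained because
  every model at least as good as \<open>P\<close> lies in the almost surely finite set.\<close>

definition cylinder :: "(nat \<Rightarrow> 'a measure) \<Rightarrow> nat \<Rightarrow> (nat \<Rightarrow> 'a) set \<Rightarrow> (nat \<Rightarrow> 'a) set" where
  "cylinder X l B = {\<omega> \<in> space (seq_space X). initial l \<omega> \<in> B}"

lemma measurable_initial [measurable]: "initial l \<in> seq_space X \<rightarrow>\<^sub>M string_space X l"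
  by (rule measurable_restrict_subset) auto

lemma measurable_initial_string:
  "j \<le> l \<Longrightarrow> (\<lambda>x. restrict x {..<j}) \<in> string_space X l \<rightarrow>\<^sub>M string_space X j"
  by (rule measurable_restrict_subset) auto

lemma initial_in_space: "\<omega> \<in> space (seq_space X) \<Longrightarrow> initial l \<omega> \<in> space (string_space X l)"
  using measurable_space[OF measurable_initial] .

lemma restrict_initial: "j \<le> l \<Longrightarrow> restrict (initial l \<omega>) {..<j} = initial j \<omega>"
  by (auto simp: restrict_def fun_eq_iff)

lemma sets_cylinder [measurable]:
  assumes [measurable]: "B \<in> sets (string_space X l)"
  shows "cylinder X l B \<in> sets (seq_space X)"
  unfolding cylinder_def by measurable

lemma sets_marginal [simp, measurable_cong]: "sets (marginal X l Q) = sets (string_space X l)"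
  by (simp add: marginal_def)

lemma space_marginal [simp]: "space (marginal X l Q) = space (string_space X l)"
  by (simp add: marginal_def)

lemma measurable_initial_cong:
  "sets Q = sets (seq_space X) \<Longrightarrow> initial l \<in> Q \<rightarrow>\<^sub>M string_space X l"
  using measurable_initial measurable_cong_sets by blast

lemma prob_space_marginal:
  "prob_space Q \<Longrightarrow> sets Q = sets (seq_space X) \<Longrightarrow> prob_space (marginal X l Q)"
  unfolding marginal_def by (rule prob_space.prob_space_distr) (auto intro: measurable_initial_cong)

lemma emeasure_marginal:
  assumes "sets Q = sets (seq_space X)" "B \<in> sets (string_space X l)"
  shows "emeasure (marginal X l Q) B = emeasure Q (cylinder X l B)"
  unfolding marginal_def cylinder_def
  using assms sets_eq_imp_space_eq[OF assms(1)]
  by (subst emeasure_distr) (auto intro: measurable_initial_cong intro!: arg_cong[where f="emeasure Q"])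

lemma AE_marginalD:
  assumes "sets Q = sets (seq_space X)" "AE x in marginal X l Q. \<Phi> x"
  shows "AE \<omega> in Q. \<Phi> (initial l \<omega>)"
  using AE_distrD[OF measurable_initial_cong[OF assms(1)] assms(2)[unfolded marginal_def]] .

text \<open>Both Doob's maximal inequality and Ville's inequality for likelihood ratios are instances.\<close>

lemma maximal_inequality:
  assumes P: "sets P = sets (seq_space X)" and Q: "sets Q = sets (seq_space X)"
    and E: "\<And>l. E l \<in> sets (string_space X l)"
    and dom: "\<And>l D. D \<in> sets (string_space X l) \<Longrightarrow> D \<subseteq> E l \<Longrightarrow>
      c * emeasure P (cylinder X l D) \<le> emeasure Q (cylinder X l D)"
  shows "c * emeasure P (\<Union>l. cylinder X l (E l)) \<le> emeasure Q (space Q)"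
proof -
  \<comment> \<open>First-entry decomposition: \<open>D l\<close> keeps the strings in
    \<open>E l\<close> none of whose proper prefixes lies in an earlier \<open>E j\<close>. The
    cylinders over the \<open>D l\<close> are disjoint with the same union, and \<open>D l\<close>
    is again a set of strings of length \<open>l\<close>, so \<open>dom\<close> applies to
    it.\<close>
  define D where "D l = E l - (\<Union>j\<in>{..<l}. {x \<in> space (string_space X l). restrict x {..<j} \<in> E j})" for l
  have D: "D l \<in> sets (string_space X l)" for l
    unfolding D_def using E measurable_sets[OF measurable_initial_string E]
    by (intro sets.Diff sets.finite_UN) (auto simp: vimage_def Int_def conj_commute)
  have disj: "disjointed (\<lambda>l. cylinder X l (E l)) = (\<lambda>l. cylinder X l (D l))"
    unfolding disjointed_def D_def cylinder_def fun_eq_iff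
    by (auto simp: initial_in_space restrict_initial simp del: restrict_restrict)
  have cyl: "range (\<lambda>l. cylinder X l (D l)) \<subseteq> sets (seq_space X)"
    using sets_cylinder[OF D] by auto
  have fam: "disjoint_family (\<lambda>l. cylinder X l (D l))"
    using disjoint_family_disjointed[of "\<lambda>l. cylinder X l (E l)"] by (simp only: disj)
  have Un: "(\<Union>l. cylinder X l (E l)) = (\<Union>l. cylinder X l (D l))"
    using UN_disjointed_eq[of "\<lambda>l. cylinder X l (E l)"] by (simp only: disj)
  have "c * emeasure P (\<Union>l. cylinder X l (E l)) = (\<Sum>l. c * emeasure P (cylinder X l (D l)))"
    unfolding Un using suminf_emeasure[of _ P] cyl fam P by (metis ennreal_suminf_cmult)
  also have "\<dots> \<le> (\<Sum>l. emeasure Q (cylinder X l (D l)))"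
    using dom[OF D] by (intro suminf_le) (auto simp: D_def)
  also have "\<dots> = emeasure Q (\<Union>l. cylinder X l (D l))"
    using suminf_emeasure[of _ Q] cyl fam Q by metis
  also have "\<dots> \<le> emeasure Q (space Q)"
    by (rule emeasure_space)
  finally show ?thesis .
qed

section \<open>Integration against a regular conditional distribution\<close>

lemma regular_conditional_prob_space:
  assumes "regular_conditional X Q l k" "x \<in> space (string_space X l)"
  shows "prob_space (k x)" "sets (k x) = sets (seq_space X)" "space (k x) = space (seq_space X)"
proof -
  have "k x \<in> space (prob_algebra (seq_space X))"
    using assms unfolding regular_conditional_def by (auto dest: measurable_space)
  then show "prob_space (k x)" and sets: "sets (k x) = sets (seq_space X)"
    by (auto simp: space_prob_algebra)
  show "space (k x) = space (seq_space X)"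
    using sets by (rule sets_eq_imp_space_eq)
qed

lemma regular_conditional_borel_measurable:
  assumes "regular_conditional X Q l k" "x \<in> space (string_space X l)"
    and "f \<in> borel_measurable (seq_space X)"
  shows "f \<in> borel_measurable (k x)"
  using assms(3) measurable_cong_sets[OF regular_conditional_prob_space(2)[OF assms(1,2)] refl] by blast

lemma regular_conditional_measurable:
  assumes "regular_conditional X Q l k" "f \<in> borel_measurable (seq_space X)"
  shows "(\<lambda>x. \<integral>\<^sup>+\<omega>. f \<omega> \<partial>k x) \<in> borel_measurable (string_space X l)"
  using assms unfolding regular_conditional_def
  by (auto intro: measurable_compose[OF measurable_prob_algebraD nn_integral_measurable_subprob_algebra])

text \<open>The defining identity is the case of indicators; linearity and monotone convergence
  extend it to all nonnegative measurable functions. The set \<open>B\<close> is carried along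
  because conditional means are later compared on arbitrary sets of strings.\<close>

lemma nn_integral_regular_conditional:
  assumes Q: "sets Q = sets (seq_space X)" and k: "regular_conditional X Q l k"
    and g: "g \<in> borel_measurable (seq_space X)"
    and B [measurable]: "B \<in> sets (string_space X l)"
  shows "(\<integral>\<^sup>+x\<in>B. (\<integral>\<^sup>+\<omega>. g \<omega> \<partial>k x) \<partial>marginal X l Q) = (\<integral>\<^sup>+\<omega>\<in>cylinder X l B. g \<omega> \<partial>Q)"
  using g
proof (induct rule: borel_measurable_induct)
  case (cong f g)
  have "(\<integral>\<^sup>+\<omega>. f \<omega> \<partial>k x) = (\<integral>\<^sup>+\<omega>. g \<omega> \<partial>k x)" if "x \<in> space (string_space X l)" for x
    using cong(3) regular_conditional_prob_space[OF k that] by (intro nn_integral_cong) auto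
  then have "(\<integral>\<^sup>+x\<in>B. (\<integral>\<^sup>+\<omega>. f \<omega> \<partial>k x) \<partial>marginal X l Q) = (\<integral>\<^sup>+x\<in>B. (\<integral>\<^sup>+\<omega>. g \<omega> \<partial>k x) \<partial>marginal X l Q)"
    by (intro nn_integral_cong) auto
  moreover have "(\<integral>\<^sup>+\<omega>\<in>cylinder X l B. f \<omega> \<partial>Q) = (\<integral>\<^sup>+\<omega>\<in>cylinder X l B. g \<omega> \<partial>Q)"
    using cong(3) sets_eq_imp_space_eq[OF Q] by (intro nn_integral_cong) auto
  ultimately show ?case using cong(4) by metis
next
  case (set A)
  have "(\<integral>\<^sup>+x\<in>B. (\<integral>\<^sup>+\<omega>. indicator A \<omega> \<partial>k x) \<partial>marginal X l Q) = (\<integral>\<^sup>+x\<in>B. emeasure (k x) A \<partial>marginal X l Q)"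
    using set regular_conditional_prob_space[OF k] by (intro nn_integral_cong) auto
  also have "\<dots> = emeasure Q (A \<inter> cylinder X l B)"
    using k set B unfolding regular_conditional_def cylinder_def by auto
  also have "\<dots> = (\<integral>\<^sup>+\<omega>. indicator (A \<inter> cylinder X l B) \<omega> \<partial>Q)"
    using set Q by simp
  also have "\<dots> = (\<integral>\<^sup>+\<omega>\<in>cylinder X l B. indicator A \<omega> \<partial>Q)"
    by (simp add: indicator_inter_arith)
  finally show ?case .
next
  case (mult u c)
  note [measurable] = regular_conditional_measurable[OF k mult(2)]
  have [measurable]: "u \<in> borel_measurable Q" using mult Q by simp
  have "(\<integral>\<^sup>+x\<in>B. (\<integral>\<^sup>+\<omega>. c * u \<omega> \<partial>k x) \<partial>marginal X l Q) = (\<integral>\<^sup>+x. c * ((\<integral>\<^sup>+\<omega>. u \<omega> \<partial>k x) * indicator B x) \<partial>marginal X l Q)"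
    using regular_conditional_borel_measurable[OF k _ mult(2)]
    by (intro nn_integral_cong) (auto simp: nn_integral_cmult mult.assoc)
  also have "\<dots> = c * (\<integral>\<^sup>+\<omega>\<in>cylinder X l B. u \<omega> \<partial>Q)"
    by (subst nn_integral_cmult) (auto simp: mult(4))
  also have "\<dots> = (\<integral>\<^sup>+\<omega>. c * (u \<omega> * indicator (cylinder X l B) \<omega>) \<partial>Q)"
    using Q by (subst nn_integral_cmult) auto
  finally show ?case by (simp add: mult.assoc)
next
  case (add u v)
  note [measurable] = regular_conditional_measurable[OF k add(1)] regular_conditional_measurable[OF k add(4)]
  have [measurable]: "u \<in> borel_measurable Q" "v \<in> borel_measurable Q" using add Q by simp_all
  have [measurable]: "cylinder X l B \<in> sets Q" using Q by simp
  have "(\<integral>\<^sup>+x\<in>B. (\<integral>\<^sup>+\<omega>. v \<omega> + u \<omega> \<partial>k x) \<partial>marginal X l Q) =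
      (\<integral>\<^sup>+x. ((\<integral>\<^sup>+\<omega>. v \<omega> \<partial>k x) * indicator B x + (\<integral>\<^sup>+\<omega>. u \<omega> \<partial>k x) * indicator B x) \<partial>marginal X l Q)"
    using regular_conditional_borel_measurable[OF k _ add(1)] regular_conditional_borel_measurable[OF k _ add(4)]
    by (intro nn_integral_cong) (auto simp: nn_integral_add distrib_right)
  also have "\<dots> = (\<integral>\<^sup>+\<omega>\<in>cylinder X l B. v \<omega> \<partial>Q) + (\<integral>\<^sup>+\<omega>\<in>cylinder X l B. u \<omega> \<partial>Q)"
    by (subst nn_integral_add) (auto simp: add(3,7))
  also have "\<dots> = (\<integral>\<^sup>+\<omega>. v \<omega> * indicator (cylinder X l B) \<omega> + u \<omega> * indicator (cylinder X l B) \<omega> \<partial>Q)"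
    by (subst nn_integral_add) auto
  finally show ?case by (simp add: distrib_right)
next
  case (seq U)
  note [measurable] = regular_conditional_measurable[OF k seq(1)]
  have [measurable]: "U i \<in> borel_measurable Q" for i using seq Q by simp
  have [measurable]: "cylinder X l B \<in> sets Q" using Q by simp
  have eq: "(\<integral>\<^sup>+\<omega>. (SUP i. U i) \<omega> \<partial>k x) = (SUP i. \<integral>\<^sup>+\<omega>. U i \<omega> \<partial>k x)" if "x \<in> space (string_space X l)" for x
    using regular_conditional_borel_measurable[OF k that seq(1)] \<open>incseq U\<close>
    unfolding SUP_apply by (intro nn_integral_monotone_convergence_SUP) auto
  have "(\<integral>\<^sup>+x\<in>B. (\<integral>\<^sup>+\<omega>. (SUP i. U i) \<omega> \<partial>k x) \<partial>marginal X l Q) =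
      (\<integral>\<^sup>+x. (SUP i. (\<integral>\<^sup>+\<omega>. U i \<omega> \<partial>k x) * indicator B x) \<partial>marginal X l Q)"
    by (intro nn_integral_cong) (auto simp: eq indicator_def simp del: Sup_apply SUP_apply)
  also have "\<dots> = (SUP i. \<integral>\<^sup>+x. (\<integral>\<^sup>+\<omega>. U i \<omega> \<partial>k x) * indicator B x \<partial>marginal X l Q)"
    using \<open>incseq U\<close>
    by (intro nn_integral_monotone_convergence_SUP)
       (auto simp: incseq_def le_fun_def intro!: mult_right_mono nn_integral_mono)
  also have "\<dots> = (SUP i. \<integral>\<^sup>+\<omega>\<in>cylinder X l B. U i \<omega> \<partial>Q)"
    using seq(3) by simp
  also have "\<dots> = (\<integral>\<^sup>+\<omega>. (SUP i. U i \<omega> * indicator (cylinder X l B) \<omega>) \<partial>Q)"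
    using \<open>incseq U\<close>
    by (intro nn_integral_monotone_convergence_SUP[symmetric])
       (auto simp: incseq_def le_fun_def intro!: mult_right_mono)
  also have "\<dots> = (\<integral>\<^sup>+\<omega>\<in>cylinder X l B. (SUP i. U i) \<omega> \<partial>Q)"
    by (intro nn_integral_cong) (auto simp: indicator_def image_comp)
  finally show ?case .
qed

subsection \<open>Lebesgue points of a filtration\<close>

text \<open>The kernels of different lengths are linked only through \<open>N\<close>. Neither
  compatibility between them nor concentration of \<open>k l x\<close> on the cylinder of
  \<open>x\<close> is assumed; almost everywhere statements of this kind have to be derived from the
  integral identity.\<close>

locale filtered_prob_space = prob_space N
  for N :: "(nat \<Rightarrow> 'a) measure" +
  fixes X :: "nat \<Rightarrow> 'a measure" and k :: "nat \<Rightarrow> (nat \<Rightarrow> 'a) \<Rightarrow> (nat \<Rightarrow> 'a) measure"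
  assumes sets_N [measurable_cong]: "sets N = sets (seq_space X)"
    and regular: "\<And>l. regular_conditional X N l (k l)"
begin

abbreviation cond :: "nat \<Rightarrow> (nat \<Rightarrow> 'a) \<Rightarrow> (nat \<Rightarrow> 'a) measure" where
  "cond l \<omega> \<equiv> k l (initial l \<omega>)"

lemma space_N: "space N = space (seq_space X)"
  using sets_N by (rule sets_eq_imp_space_eq)

lemma borel_N: "f \<in> borel_measurable N \<longleftrightarrow> f \<in> borel_measurable (seq_space X)"
  using measurable_cong_sets[OF sets_N refl] by blast

lemma cond_props:
  assumes "\<omega> \<in> space N"
  shows "prob_space (cond l \<omega>)" "sets (cond l \<omega>) = sets (seq_space X)" "space (cond l \<omega>) = space (seq_space X)"
  using regular_conditional_prob_space[OF regular initial_in_space] assms by (auto simp: space_N)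

lemma borel_cond:
  assumes "\<omega> \<in> space N" "f \<in> borel_measurable N"
  shows "f \<in> borel_measurable (cond l \<omega>)"
  using regular_conditional_borel_measurable[OF regular initial_in_space] assms by (auto simp: space_N borel_N)

lemma measurable_nn_integral_kernel:
  "g \<in> borel_measurable N \<Longrightarrow> (\<lambda>x. \<integral>\<^sup>+\<omega>'. g \<omega>' \<partial>k l x) \<in> borel_measurable (string_space X l)"
  using regular_conditional_measurable[OF regular] by (simp add: borel_N)

lemma measurable_nn_integral_cond:
  assumes "g \<in> borel_measurable N"
  shows "(\<lambda>\<omega>. \<integral>\<^sup>+\<omega>'. g \<omega>' \<partial>cond l \<omega>) \<in> borel_measurable N"
  using measurable_compose[OF measurable_initial_cong[OF sets_N] measurable_nn_integral_kernel[OF assms]] .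

lemma cylinder_N [measurable]: "B \<in> sets (string_space X l) \<Longrightarrow> cylinder X l B \<in> sets N"
  using sets_cylinder sets_N by blast

lemma nn_integral_kernel:
  assumes "g \<in> borel_measurable N" "B \<in> sets (string_space X l)"
  shows "(\<integral>\<^sup>+x\<in>B. (\<integral>\<^sup>+\<omega>. g \<omega> \<partial>k l x) \<partial>marginal X l N) = (\<integral>\<^sup>+\<omega>\<in>cylinder X l B. g \<omega> \<partial>N)"
  using nn_integral_regular_conditional[OF sets_N regular _ assms(2)] assms(1) by (simp add: borel_N)

lemma nn_integral_kernel_space:
  assumes "g \<in> borel_measurable N"
  shows "(\<integral>\<^sup>+x. (\<integral>\<^sup>+\<omega>. g \<omega> \<partial>k l x) \<partial>marginal X l N) = (\<integral>\<^sup>+\<omega>. g \<omega> \<partial>N)"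
proof -
  have "(\<integral>\<^sup>+x. (\<integral>\<^sup>+\<omega>. g \<omega> \<partial>k l x) \<partial>marginal X l N) =
      (\<integral>\<^sup>+x\<in>space (string_space X l). (\<integral>\<^sup>+\<omega>. g \<omega> \<partial>k l x) \<partial>marginal X l N)"
    by (intro nn_integral_cong) auto
  also have "\<dots> = (\<integral>\<^sup>+\<omega>\<in>cylinder X l (space (string_space X l)). g \<omega> \<partial>N)"
    by (intro nn_integral_kernel assms) simp
  also have "\<dots> = (\<integral>\<^sup>+\<omega>. g \<omega> \<partial>N)"
    by (intro nn_integral_cong) (auto simp: cylinder_def space_N initial_in_space)
  finally show ?thesis .
qed

text \<open>The \<open>N\<close>-mean of the conditional probability of a null set is
  \<open>0\<close>, so this probability vanishes almost everywhere; countably many lengths cost only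
  one null set. Modifications on \<open>N\<close>-null sets thus remain invisible under the
  conditional distributions.\<close>

lemma AE_cond:
  assumes "AE \<omega> in N. \<Phi> \<omega>"
  shows "AE \<omega> in N. \<forall>l. AE \<omega>' in cond l \<omega>. \<Phi> \<omega>'"
proof -
  obtain A where A: "{\<omega>\<in>space N. \<not> \<Phi> \<omega>} \<subseteq> A" "emeasure N A = 0" "A \<in> sets N"
    using AE_E[OF assms] by blast
  have "AE \<omega> in N. AE \<omega>' in cond l \<omega>. \<Phi> \<omega>'" for l
  proof -
    have "(\<integral>\<^sup>+x. (\<integral>\<^sup>+\<omega>. indicator A \<omega> \<partial>k l x) \<partial>marginal X l N) = 0"
      using A by (subst nn_integral_kernel_space) auto
    then have "AE x in marginal X l N. (\<integral>\<^sup>+\<omega>. indicator A \<omega> \<partial>k l x) = 0"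
      using measurable_nn_integral_kernel[of "indicator A" l] A(3) by (subst (asm) nn_integral_0_iff_AE) auto
    from AE_marginalD[OF sets_N this] AE_space show ?thesis
    proof eventually_elim
      case (elim \<omega>)
      have "A \<in> sets (cond l \<omega>)" using A(3) cond_props[OF elim(2)] sets_N by simp
      then have "A \<in> null_sets (cond l \<omega>)" using elim by (auto simp: null_sets_def)
      then show ?case
        by (rule AE_I') (use A(1) cond_props[OF elim(2)] space_N in auto)
    qed
  qed
  then show ?thesis by (simp add: AE_all_countable)
qed

text \<open>Doob's inequality for the conditional means of \<open>g\<close>: the second measure is
  \<open>density N g\<close>, and on strings where the conditional mean is at least
  \<open>\<delta>\<close>, integration over a set of such strings gives the required domination of
  \<open>N\<close>.\<close>

lemma maximal_inequality_cond:
  assumes g [measurable]: "g \<in> borel_measurable N"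
  shows "\<delta> * emeasure N (\<Union>l. {\<omega>\<in>space N. \<delta> \<le> (\<integral>\<^sup>+\<omega>'. g \<omega>' \<partial>cond l \<omega>)}) \<le> (\<integral>\<^sup>+\<omega>. g \<omega> \<partial>N)"
proof -
  define E where "E l = {x\<in>space (string_space X l). \<delta> \<le> (\<integral>\<^sup>+\<omega>. g \<omega> \<partial>k l x)}" for l
  note [measurable] = measurable_nn_integral_kernel[OF g]
  have E: "E l \<in> sets (string_space X l)" for l unfolding E_def by measurable
  have eq: "{\<omega>\<in>space N. \<delta> \<le> (\<integral>\<^sup>+\<omega>'. g \<omega>' \<partial>cond l \<omega>)} = cylinder X l (E l)" for l
    by (auto simp: cylinder_def E_def space_N initial_in_space)
  have "\<delta> * emeasure N (\<Union>l. cylinder X l (E l)) \<le> emeasure (density N g) (space (density N g))"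
  proof (rule maximal_inequality[OF sets_N _ E])
    fix l D assume D [measurable]: "D \<in> sets (string_space X l)" and "D \<subseteq> E l"
    have "\<delta> * emeasure N (cylinder X l D) = (\<integral>\<^sup>+x\<in>D. \<delta> \<partial>marginal X l N)"
      using D by (simp add: nn_integral_cmult emeasure_marginal[OF sets_N])
    also have "\<dots> \<le> (\<integral>\<^sup>+x\<in>D. (\<integral>\<^sup>+\<omega>. g \<omega> \<partial>k l x) \<partial>marginal X l N)"
      using \<open>D \<subseteq> E l\<close> by (intro nn_integral_mono) (auto simp: E_def indicator_def)
    also have "\<dots> = emeasure (density N g) (cylinder X l D)"
      using nn_integral_kernel[OF g D] by (simp add: emeasure_density)
    finally show "\<delta> * emeasure N (cylinder X l D) \<le> emeasure (density N g) (cylinder X l D)" .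
  qed (simp add: sets_N)
  also have "\<dots> = (\<integral>\<^sup>+\<omega>. g \<omega> \<partial>N)" by (simp add: emeasure_density cong: nn_integral_cong)
  finally show ?thesis by (simp add: eq)
qed

section \<open>Mean oscillation around a point\<close>

text \<open>The point \<open>\<omega>\<close> enters twice, as the history that is conditioned on
  and as the centre \<open>f \<omega>\<close>. Hence \<open>osc f l\<close> is in general not a
  function of the first \<open>l\<close> coordinates, and the maximal inequality does not apply to
  it directly.\<close>

definition osc :: "((nat \<Rightarrow> 'a) \<Rightarrow> real) \<Rightarrow> nat \<Rightarrow> (nat \<Rightarrow> 'a) \<Rightarrow> ennreal" where
  "osc f l \<omega> = (\<integral>\<^sup>+\<omega>'. ennreal \<bar>f \<omega>' - f \<omega>\<bar> \<partial>cond l \<omega>)"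

text \<open>The analogue of Lebesgue's differentiation theorem, with the conditional distributions
  in place of averages over shrinking balls: almost every point is a Lebesgue point of
  \<open>f\<close>.\<close>

definition lebesgue_regular :: "((nat \<Rightarrow> 'a) \<Rightarrow> real) \<Rightarrow> bool" where
  "lebesgue_regular f \<longleftrightarrow> f \<in> borel_measurable N \<and> (AE \<omega> in N. (\<lambda>l. osc f l \<omega>) \<longlonglongrightarrow> 0)"

text \<open>The first term is a conditional mean and so falls under the maximal inequality, the last
  is a value at the point and falls under Markov's inequality, and the middle one vanishes in the
  limit if \<open>s\<close> is regular.\<close>

lemma osc_triangle:
  assumes "\<omega> \<in> space N" and [measurable]: "f \<in> borel_measurable N" "s \<in> borel_measurable N"
  shows "osc f l \<omega> \<le> (\<integral>\<^sup>+\<omega>'. ennreal \<bar>f \<omega>' - s \<omega>'\<bar> \<partial>cond l \<omega>) + osc s l \<omega> + ennreal \<bar>f \<omega> - s \<omega>\<bar>"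
proof -
  interpret c: prob_space "cond l \<omega>" by (rule cond_props[OF assms(1)])
  note [measurable] = borel_cond[OF assms(1) assms(2)] borel_cond[OF assms(1) assms(3)]
  have "osc f l \<omega> \<le> (\<integral>\<^sup>+\<omega>'. ennreal \<bar>f \<omega>' - s \<omega>'\<bar> + ennreal \<bar>s \<omega>' - s \<omega>\<bar> + ennreal \<bar>f \<omega> - s \<omega>\<bar> \<partial>cond l \<omega>)"
    unfolding osc_def
    by (intro nn_integral_mono) (simp add: ennreal_plus[symmetric] del: ennreal_plus)
  also have "\<dots> = (\<integral>\<^sup>+\<omega>'. ennreal \<bar>f \<omega>' - s \<omega>'\<bar> \<partial>cond l \<omega>) + osc s l \<omega> + ennreal \<bar>f \<omega> - s \<omega>\<bar>"
    unfolding osc_def by (simp add: nn_integral_add c.emeasure_space_1)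
  finally show ?thesis .
qed

text \<open>The usual density argument: regularity passes to \<open>L1\<close> limits because the
  error made by an approximant is controlled simultaneously for all \<open>l\<close> by a maximal
  inequality.\<close>

lemma lebesgue_regular_limit:
  assumes f [measurable]: "f \<in> borel_measurable N" and s: "\<And>n. lebesgue_regular (s n)"
    and lim: "(\<lambda>n. \<integral>\<^sup>+\<omega>. ennreal \<bar>f \<omega> - s n \<omega>\<bar> \<partial>N) \<longlonglongrightarrow> 0"
  shows "lebesgue_regular f"
proof -
  have s_meas [measurable]: "s n \<in> borel_measurable N" for n
    using s by (auto simp: lebesgue_regular_def)
  define g where "g n \<omega> = ennreal \<bar>f \<omega> - s n \<omega>\<bar>" for n \<omega>
  have g_meas [measurable]: "g n \<in> borel_measurable N" for n unfolding g_def by measurable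
  note [measurable] = measurable_nn_integral_cond[OF g_meas]
  have approx: "AE \<omega> in N. \<exists>n. g n \<omega> < ennreal \<epsilon> \<and> (\<forall>l. (\<integral>\<^sup>+\<omega>'. g n \<omega>' \<partial>cond l \<omega>) < ennreal \<epsilon>)"
    if "\<epsilon> > 0" for \<epsilon>
  proof -
    \<comment> \<open>The points at which the \<open>n\<close>-th approximant is bad. The maximal
      inequality bounds the first part and Markov's inequality the second, each by the
      \<open>L1\<close> distance divided by \<open>\<epsilon>\<close>; hence the factor
      \<open>2\<close> below.\<close>
    define B where "B n = (\<Union>l. {\<omega>\<in>space N. ennreal \<epsilon> \<le> (\<integral>\<^sup>+\<omega>'. g n \<omega>' \<partial>cond l \<omega>)}) \<union>
      {\<omega>\<in>space N. ennreal \<epsilon> \<le> g n \<omega>}" for n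
    have B_meas [measurable]: "B n \<in> sets N" for n unfolding B_def by measurable
    have B: "ennreal \<epsilon> * emeasure N (B n) \<le> 2 * (\<integral>\<^sup>+\<omega>. g n \<omega> \<partial>N)" for n
    proof -
      have "ennreal \<epsilon> * emeasure N (B n) \<le>
          ennreal \<epsilon> * (emeasure N (\<Union>l. {\<omega>\<in>space N. ennreal \<epsilon> \<le> (\<integral>\<^sup>+\<omega>'. g n \<omega>' \<partial>cond l \<omega>)}) +
            emeasure N {\<omega>\<in>space N. ennreal \<epsilon> \<le> g n \<omega>})"
        unfolding B_def by (intro mult_left_mono emeasure_subadditive) auto
      also have "\<dots> \<le> (\<integral>\<^sup>+\<omega>. g n \<omega> \<partial>N) + (\<integral>\<^sup>+\<omega>. g n \<omega> \<partial>N)"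
        unfolding distrib_left
      proof (intro add_mono maximal_inequality_cond)
        have "ennreal \<epsilon> * emeasure N {\<omega>\<in>space N. ennreal \<epsilon> \<le> g n \<omega>} = (\<integral>\<^sup>+\<omega>\<in>{\<omega>\<in>space N. ennreal \<epsilon> \<le> g n \<omega>}. ennreal \<epsilon> \<partial>N)"
          by (simp add: nn_integral_cmult)
        also have "\<dots> \<le> (\<integral>\<^sup>+\<omega>. g n \<omega> \<partial>N)"
          by (intro nn_integral_mono) (auto simp: indicator_def)
        finally show "ennreal \<epsilon> * emeasure N {\<omega>\<in>space N. ennreal \<epsilon> \<le> g n \<omega>} \<le> (\<integral>\<^sup>+\<omega>. g n \<omega> \<partial>N)" .
      qed (rule g_meas)
      finally show ?thesis by (simp add: mult_2)
    qed
    \<comment> \<open>Each point needs only one good approximant, so the intersection of the bad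
      sets has to be null. Convergence of the \<open>L1\<close> distances to \<open>0\<close> is
      enough for this, without any rate.\<close>
    have "ennreal \<epsilon> * emeasure N (\<Inter>n. B n) \<le> 0"
    proof (rule LIMSEQ_le_const)
      have "(\<lambda>n. 2 * (\<integral>\<^sup>+\<omega>. g n \<omega> \<partial>N)) \<longlonglongrightarrow> 2 * 0"
        using lim unfolding g_def by (intro ennreal_tendsto_cmult) auto
      then show "(\<lambda>n. 2 * (\<integral>\<^sup>+\<omega>. g n \<omega> \<partial>N)) \<longlonglongrightarrow> 0" by simp
      have "ennreal \<epsilon> * emeasure N (\<Inter>n. B n) \<le> 2 * (\<integral>\<^sup>+\<omega>. g n \<omega> \<partial>N)" for n
        by (rule order_trans[OF mult_left_mono[OF emeasure_mono] B]) auto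
      then show "\<exists>m. \<forall>n\<ge>m. ennreal \<epsilon> * emeasure N (\<Inter>n. B n) \<le> 2 * (\<integral>\<^sup>+\<omega>. g n \<omega> \<partial>N)" by blast
    qed
    then have "(\<Inter>n. B n) \<in> null_sets N" using that by (auto simp: null_sets_def)
    then show ?thesis
      by (rule AE_I') (auto simp: B_def not_less)
  qed
  have "AE \<omega> in N. \<forall>m. \<exists>n. g n \<omega> < ennreal (1 / Suc m) \<and> (\<forall>l. (\<integral>\<^sup>+\<omega>'. g n \<omega>' \<partial>cond l \<omega>) < ennreal (1 / Suc m))"
    by (intro AE_all_countable[THEN iffD2] allI approx) simp
  moreover have "AE \<omega> in N. \<forall>n. (\<lambda>l. osc (s n) l \<omega>) \<longlonglongrightarrow> 0"
    using s by (auto simp: AE_all_countable lebesgue_regular_def)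
  ultimately have "AE \<omega> in N. (\<lambda>l. osc f l \<omega>) \<longlonglongrightarrow> 0"
    using AE_space
  proof eventually_elim
    case (elim \<omega>)
    show ?case
    proof (rule order_tendstoI)
      fix a :: ennreal assume "0 < a"
      obtain b where "0 < b" "b < a" using dense[OF \<open>0 < a\<close>] by blast
      then obtain r where r: "0 < r" "ennreal r < a" by (cases b) auto
      obtain m where m: "1 / Suc m < r / 3" using r(1) nat_approx_posE[of "r / 3"] by auto
      obtain n where n: "g n \<omega> < ennreal (1 / Suc m)" "\<And>l. (\<integral>\<^sup>+\<omega>'. g n \<omega>' \<partial>cond l \<omega>) < ennreal (1 / Suc m)"
        using elim(1) by blast
      have "\<forall>\<^sub>F l in sequentially. osc (s n) l \<omega> < ennreal (1 / Suc m)"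
        using elim(2) by (intro order_tendstoD) auto
      then show "\<forall>\<^sub>F l in sequentially. osc f l \<omega> < a"
      proof eventually_elim
        case l: (elim l)
        have "osc f l \<omega> \<le> (\<integral>\<^sup>+\<omega>'. g n \<omega>' \<partial>cond l \<omega>) + osc (s n) l \<omega> + g n \<omega>"
          unfolding g_def using elim(3) by (intro osc_triangle) auto
        also have "\<dots> \<le> ennreal (1 / Suc m) + ennreal (1 / Suc m) + ennreal (1 / Suc m)"
          using n(1) n(2)[of l] l by (intro add_mono) auto
        also have "\<dots> = ennreal (3 * (1 / Suc m))"
          by (simp add: ennreal_plus[symmetric] del: ennreal_plus)
        also have "\<dots> \<le> ennreal r" using m by (intro ennreal_leI) auto
        finally show "osc f l \<omega> < a" using r(2) by simp
      qed
    qed auto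
  qed
  then show ?thesis by (simp add: lebesgue_regular_def)
qed

lemma lebesgue_regular_add:
  assumes "lebesgue_regular f" "lebesgue_regular g"
  shows "lebesgue_regular (\<lambda>\<omega>. f \<omega> + g \<omega>)"
proof -
  have [measurable]: "f \<in> borel_measurable N" "g \<in> borel_measurable N"
    using assms by (auto simp: lebesgue_regular_def)
  have "AE \<omega> in N. (\<lambda>l. osc f l \<omega>) \<longlonglongrightarrow> 0" "AE \<omega> in N. (\<lambda>l. osc g l \<omega>) \<longlonglongrightarrow> 0"
    using assms by (auto simp: lebesgue_regular_def)
  then have "AE \<omega> in N. (\<lambda>l. osc (\<lambda>\<omega>. f \<omega> + g \<omega>) l \<omega>) \<longlonglongrightarrow> 0"
    using AE_space
  proof eventually_elim
    case (elim \<omega>)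
    have bound: "osc (\<lambda>\<omega>. f \<omega> + g \<omega>) l \<omega> \<le> osc f l \<omega> + osc g l \<omega>" for l
    proof -
      note [measurable] = borel_cond[OF elim(3), of f l] borel_cond[OF elim(3), of g l]
      have "osc (\<lambda>\<omega>. f \<omega> + g \<omega>) l \<omega> \<le> (\<integral>\<^sup>+\<omega>'. ennreal \<bar>f \<omega>' - f \<omega>\<bar> + ennreal \<bar>g \<omega>' - g \<omega>\<bar> \<partial>cond l \<omega>)"
        unfolding osc_def
        by (intro nn_integral_mono) (simp add: ennreal_plus[symmetric] del: ennreal_plus)
      also have "\<dots> = osc f l \<omega> + osc g l \<omega>"
        unfolding osc_def by (rule nn_integral_add) measurable
      finally show ?thesis .
    qed
    have "(\<lambda>l. osc f l \<omega> + osc g l \<omega>) \<longlonglongrightarrow> 0"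
      using tendsto_add[OF elim(1,2)] by simp
    from tendsto_sandwich[OF _ _ tendsto_const this, of "\<lambda>l. osc (\<lambda>\<omega>. f \<omega> + g \<omega>) l \<omega>"] show ?case
      by (simp add: bound)
  qed
  then show ?thesis by (simp add: lebesgue_regular_def)
qed

lemma lebesgue_regular_cmult:
  assumes "lebesgue_regular f"
  shows "lebesgue_regular (\<lambda>\<omega>. c * f \<omega>)"
proof -
  have [measurable]: "f \<in> borel_measurable N"
    using assms by (auto simp: lebesgue_regular_def)
  have "AE \<omega> in N. (\<lambda>l. osc f l \<omega>) \<longlonglongrightarrow> 0"
    using assms by (auto simp: lebesgue_regular_def)
  then have "AE \<omega> in N. (\<lambda>l. osc (\<lambda>\<omega>. c * f \<omega>) l \<omega>) \<longlonglongrightarrow> 0"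
    using AE_space
  proof eventually_elim
    case (elim \<omega>)
    have "osc (\<lambda>\<omega>. c * f \<omega>) l \<omega> = ennreal \<bar>c\<bar> * osc f l \<omega>" for l
    proof -
      note [measurable] = borel_cond[OF elim(2), of f l]
      show ?thesis
        unfolding osc_def
        by (subst nn_integral_cmult[symmetric])
           (auto simp: ennreal_mult[symmetric] abs_mult[symmetric] right_diff_distrib intro!: nn_integral_cong)
    qed
    moreover have "(\<lambda>l. ennreal \<bar>c\<bar> * osc f l \<omega>) \<longlonglongrightarrow> ennreal \<bar>c\<bar> * 0"
      using elim(1) by (intro ennreal_tendsto_cmult) auto
    ultimately show ?case by simp
  qed
  then show ?thesis by (simp add: lebesgue_regular_def)
qed

lemma lebesgue_regular_const: "lebesgue_regular (\<lambda>_. c)"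
  by (simp add: lebesgue_regular_def osc_def)

text \<open>From length \<open>m\<close> on the event is decided by the observed string. The
  conditional probability and the indicator of the deciding strings \<open>?C\<close> have the same
  integral over every set of strings, so they agree almost everywhere. Hence
  \<open>cond l \<omega>\<close> charges only the side of the event on which \<open>\<omega>\<close>
  lies, and the oscillation is \<open>0\<close>.\<close>

lemma lebesgue_regular_cylinder:
  assumes B [measurable]: "B \<in> sets (string_space X m)"
  shows "lebesgue_regular (indicator (cylinder X m B))"
proof -
  let ?A = "cylinder X m B"
  have zero: "AE \<omega> in N. osc (indicator ?A) l \<omega> = 0" if "m \<le> l" for l
  proof -
    let ?C = "{x\<in>space (string_space X l). restrict x {..<m} \<in> B}"
    have C [measurable]: "?C \<in> sets (string_space X l)"
      using measurable_sets[OF measurable_initial_string[OF that] B] by (simp add: vimage_def Int_def conj_commute)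
    have cyl: "cylinder X l ?C = ?A"
      using that by (auto simp: cylinder_def initial_in_space restrict_initial simp del: restrict_restrict)
    interpret ml: prob_space "marginal X l N"
      by (rule prob_space_marginal) (unfold_locales, rule sets_N)
    have "AE x in marginal X l N. (\<integral>\<^sup>+\<omega>. indicator ?A \<omega> \<partial>k l x) = indicator ?C x"
    proof (rule ml.density_unique2)
      show "(\<lambda>x. \<integral>\<^sup>+\<omega>. indicator ?A \<omega> \<partial>k l x) \<in> borel_measurable (marginal X l N)"
        using measurable_nn_integral_kernel[of "indicator ?A" l] by simp
      fix D assume "D \<in> sets (marginal X l N)"
      then have D [measurable]: "D \<in> sets (string_space X l)" by simp
      have "(\<integral>\<^sup>+x\<in>D. (\<integral>\<^sup>+\<omega>. indicator ?A \<omega> \<partial>k l x) \<partial>marginal X l N) = (\<integral>\<^sup>+\<omega>\<in>cylinder X l D. indicator ?A \<omega> \<partial>N)"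
        by (rule nn_integral_kernel) auto
      also have "\<dots> = emeasure N (cylinder X l (?C \<inter> D))"
      proof -
        have "cylinder X l (?C \<inter> D) = ?A \<inter> cylinder X l D"
          unfolding cyl[symmetric] by (auto simp: cylinder_def)
        then show ?thesis
          by (simp add: indicator_inter_arith[symmetric])
      qed
      also have "\<dots> = (\<integral>\<^sup>+x\<in>D. indicator ?C x \<partial>marginal X l N)"
        by (simp add: indicator_inter_arith[symmetric] emeasure_marginal[OF sets_N])
      finally show "(\<integral>\<^sup>+x\<in>D. (\<integral>\<^sup>+\<omega>. indicator ?A \<omega> \<partial>k l x) \<partial>marginal X l N) = (\<integral>\<^sup>+x\<in>D. indicator ?C x \<partial>marginal X l N)" .
    qed simp
    from AE_marginalD[OF sets_N this] AE_space show ?thesis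
    proof eventually_elim
      case (elim \<omega>)
      interpret c: prob_space "cond l \<omega>" by (rule cond_props[OF elim(2)])
      have A: "?A \<in> sets (cond l \<omega>)" using cond_props[OF elim(2)] by auto
      then have [measurable]: "?A \<in> sets (cond l \<omega>)" .
      have em: "emeasure (cond l \<omega>) ?A = indicator ?A \<omega>"
      proof -
        have "emeasure (cond l \<omega>) ?A = (\<integral>\<^sup>+\<omega>'. indicator ?A \<omega>' \<partial>cond l \<omega>)"
          using A by simp
        also have "\<dots> = indicator ?C (initial l \<omega>)" by (rule elim(1))
        also have "\<dots> = indicator (cylinder X l ?C) \<omega>"
          using elim(2) unfolding cylinder_def space_N by (simp add: indicator_def)
        finally show ?thesis unfolding cyl .
      qed
      show ?case
      proof (cases "\<omega> \<in> ?A")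
        case True
        then have "AE \<omega>' in cond l \<omega>. \<omega>' \<in> ?A"
          using c.AE_in_set_eq_1[OF A] em by (simp add: c.emeasure_eq_measure)
        then show ?thesis
          unfolding osc_def using True by (subst nn_integral_0_iff_AE) (auto elim: eventually_mono)
      next
        case False
        then have "AE \<omega>' in cond l \<omega>. \<omega>' \<notin> ?A"
          using em A by (intro AE_not_in) (auto simp: null_sets_def)
        then show ?thesis
          unfolding osc_def using False by (subst nn_integral_0_iff_AE) (auto elim: eventually_mono)
      qed
    qed
  qed
  then have "AE \<omega> in N. \<forall>l. m \<le> l \<longrightarrow> osc (indicator ?A) l \<omega> = 0"
    by (intro AE_all_countable[THEN iffD2] allI) auto
  then have "AE \<omega> in N. (\<lambda>l. osc (indicator ?A) l \<omega>) \<longlonglongrightarrow> 0"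
    by eventually_elim (auto intro!: tendsto_eventually eventually_sequentiallyI[of m])
  then show ?thesis by (simp add: lebesgue_regular_def)
qed

text \<open>The events with a regular indicator form a Dynkin system by the closure properties
  above, and it contains the finite-dimensional rectangles, which are stable under intersection and
  generate the product field.\<close>

lemma lebesgue_regular_indicator:
  assumes "A \<in> sets N"
  shows "lebesgue_regular (indicator A)"
proof -
  have "A \<in> sigma_sets (\<Pi>\<^sub>E i\<in>UNIV. space (X i)) (prod_algebra UNIV X)"
    using assms by (simp add: sets_N sets_PiM)
  then show ?thesis
  proof (induct rule: sigma_sets_induct_disjoint[OF Int_stable_prod_algebra prod_algebra_sets_into_space, consumes 1, case_names basic empty compl union])
    case (basic A)
    obtain J E where A: "A = prod_emb UNIV X J (\<Pi>\<^sub>E j\<in>J. E j)" "finite J"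
      "\<And>i. i \<in> J \<Longrightarrow> E i \<in> sets (X i)"
      using prod_algebraE[OF basic] by metis
    obtain m where m: "J \<subseteq> {..<m}" using A(2) finite_nat_iff_bounded by auto
    have "prod_emb {..<m} X J (\<Pi>\<^sub>E j\<in>J. E j) \<in> sets (string_space X m)"
      using A m by (intro measurable_prod_emb sets_PiM_I_finite) auto
    moreover have "A = cylinder X m (prod_emb {..<m} X J (\<Pi>\<^sub>E j\<in>J. E j))"
      using m unfolding A by (auto simp: cylinder_def prod_emb_def space_PiM Int_absorb1 Int_absorb2)
    ultimately show ?case using lebesgue_regular_cylinder by simp
  next
    case empty
    have "indicator {} = (\<lambda>_. 0 :: real)" by (auto simp: fun_eq_iff)
    then show ?case using lebesgue_regular_const[of 0] by simp
  next
    case (compl A)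
    have *: "lebesgue_regular (\<lambda>\<omega>. 1 + (-1) * indicator A \<omega>)"
      using compl by (intro lebesgue_regular_add lebesgue_regular_cmult lebesgue_regular_const)
    let ?C = "(\<Pi>\<^sub>E i\<in>UNIV. space (X i)) - A"
    have "A \<in> sets N" using compl by (simp add: sets_N sets_PiM)
    then have [measurable]: "?C \<in> sets N" by (simp add: sets_N sets_PiM sigma_sets.Compl)
    show ?case
    \<comment> \<open>A constant approximating sequence: the indicator of the complement equals
      \<open>1 + (-1) * indicator A \<omega>\<close> only on the space of \<open>N\<close>, and the
      limit lemma absorbs the difference outside it.\<close>
    proof (rule lebesgue_regular_limit[of _ "\<lambda>_ \<omega>. 1 + (-1) * indicator A \<omega>"])
      have "(\<integral>\<^sup>+\<omega>. ennreal \<bar>indicator ?C \<omega> - (1 + (-1) * indicator A \<omega>)\<bar> \<partial>N) = (\<integral>\<^sup>+\<omega>. 0 \<partial>N)"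
        by (intro nn_integral_cong) (auto simp: space_N space_PiM indicator_def)
      then show "(\<lambda>n. \<integral>\<^sup>+\<omega>. ennreal \<bar>indicator ?C \<omega> - (1 + (-1) * indicator A \<omega>)\<bar> \<partial>N) \<longlonglongrightarrow> 0"
        by simp
    qed (simp, rule *)
  next
    case (union A)
    have A [measurable]: "A i \<in> sets N" for i using union by (simp add: sets_N sets_PiM image_subset_iff)
    have fin: "lebesgue_regular (\<lambda>\<omega>. \<Sum>i<n. indicator (A i) \<omega>)" for n
      by (induct n) (auto intro: lebesgue_regular_const lebesgue_regular_add union)
    show ?case
    proof (rule lebesgue_regular_limit[OF _ fin])
      \<comment> \<open>By disjointness the partial sums are indicators of the partial unions, so
        this sequence, the mass of the tail, is the \<open>L1\<close> distance to the indicator of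
        the whole union.\<close>
      have "(\<lambda>n. measure N (\<Union>i. A i) - (\<Sum>i<n. measure N (A i))) \<longlonglongrightarrow> measure N (\<Union>i. A i) - measure N (\<Union>i. A i)"
        using finite_measure_UNION[OF image_subsetI[OF A] union(1)] by (intro tendsto_intros) (auto simp: sums_def)
      then have "(\<lambda>n. ennreal (measure N (\<Union>i. A i) - (\<Sum>i<n. measure N (A i)))) \<longlonglongrightarrow> 0"
        using tendsto_ennrealI by fastforce
      moreover have "(\<integral>\<^sup>+\<omega>. ennreal \<bar>indicator (\<Union>i. A i) \<omega> - (\<Sum>i<n. indicator (A i) \<omega>)\<bar> \<partial>N) =
          ennreal (measure N (\<Union>i. A i) - (\<Sum>i<n. measure N (A i)))" for n
      proof -
        have le: "(\<Sum>i<n. indicator (A i) \<omega>) \<le> (indicator (\<Union>i. A i) \<omega> :: real)" for \<omega>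
        proof -
          have "(\<Sum>i<n. indicator (A i) \<omega>) = (indicator (\<Union>i<n. A i) \<omega> :: real)"
            using union(1) by (intro indicator_UN_disjoint[symmetric]) (auto simp: disjoint_family_on_def)
          then show ?thesis by (auto simp: indicator_def)
        qed
        have "(\<integral>\<^sup>+\<omega>. ennreal \<bar>indicator (\<Union>i. A i) \<omega> - (\<Sum>i<n. indicator (A i) \<omega>)\<bar> \<partial>N) =
            (\<integral>\<^sup>+\<omega>. ennreal (indicator (\<Union>i. A i) \<omega> - (\<Sum>i<n. indicator (A i) \<omega>)) \<partial>N)"
          using le by (intro nn_integral_cong) simp
        also have "\<dots> = ennreal (\<integral>\<omega>. indicator (\<Union>i. A i) \<omega> - (\<Sum>i<n. indicator (A i) \<omega>) \<partial>N)"
          using le by (intro nn_integral_eq_integral) (auto simp: emeasure_eq_measure)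
        also have "(\<integral>\<omega>. indicator (\<Union>i. A i) \<omega> - (\<Sum>i<n. indicator (A i) \<omega>) \<partial>N) =
            measure N (\<Union>i. A i) - (\<Sum>i<n. measure N (A i))"
          by (subst Bochner_Integration.integral_diff) (auto simp: emeasure_eq_measure)
        finally show ?thesis .
      qed
      ultimately show "(\<lambda>n. \<integral>\<^sup>+\<omega>. ennreal \<bar>indicator (\<Union>i. A i) \<omega> - (\<Sum>i<n. indicator (A i) \<omega>)\<bar> \<partial>N) \<longlonglongrightarrow> 0"
        by simp
    qed simp
  qed
qed

text \<open>
  Stronger than Levy's upward theorem: \<open>f\<close> is compared with the constant \<open>f \<omega>\<close> inside the
  conditional expectation, which is what yields convergence uniformly over events.
\<close>

lemma integrable_imp_lebesgue_regular:
  assumes "integrable N f"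
  shows "lebesgue_regular f"
  using assms
proof (induct rule: integrable_induct)
  case (base A c)
  then show ?case
    using lebesgue_regular_cmult[OF lebesgue_regular_indicator, of A c] by (simp add: mult.commute)
next
  case (add f g)
  then show ?case by (simp add: lebesgue_regular_add)
next
  case (lim f s)
  have [measurable]: "f \<in> borel_measurable N" "s n \<in> borel_measurable N" for n
    using lim by auto
  show ?case
  proof (rule lebesgue_regular_limit[OF _ lim(2)])
    have "(\<lambda>n. \<integral>\<omega>. \<bar>f \<omega> - s n \<omega>\<bar> \<partial>N) \<longlonglongrightarrow> (\<integral>\<omega>. 0 \<partial>N)"
    proof (rule integral_dominated_convergence)
      \<comment> \<open>The induction rule supplies approximants bounded by
        \<open>2 * \<bar>f \<omega>\<bar>\<close>; adding \<open>\<bar>f \<omega>\<bar>\<close>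
        itself gives the \<open>3\<close>.\<close>
      show "integrable N (\<lambda>\<omega>. 3 * \<bar>f \<omega>\<bar>)" using lim by auto
      have "(\<lambda>n. \<bar>f \<omega> - s n \<omega>\<bar>) \<longlonglongrightarrow> \<bar>f \<omega> - f \<omega>\<bar>" if "\<omega> \<in> space N" for \<omega>
        using lim(3)[OF that] by (intro tendsto_intros)
      then show "AE \<omega> in N. (\<lambda>n. \<bar>f \<omega> - s n \<omega>\<bar>) \<longlonglongrightarrow> 0" by (auto intro!: AE_I2)
      have "norm \<bar>f \<omega> - s n \<omega>\<bar> \<le> 3 * \<bar>f \<omega>\<bar>" if "\<omega> \<in> space N" for n \<omega>
        using lim(4)[OF that, of n] by auto
      then show "AE \<omega> in N. norm \<bar>f \<omega> - s n \<omega>\<bar> \<le> 3 * \<bar>f \<omega>\<bar>" for n by (auto intro!: AE_I2)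
    qed auto
    then have "(\<lambda>n. ennreal (\<integral>\<omega>. \<bar>f \<omega> - s n \<omega>\<bar> \<partial>N)) \<longlonglongrightarrow> 0"
      using tendsto_ennrealI by fastforce
    moreover have "(\<integral>\<^sup>+\<omega>. ennreal \<bar>f \<omega> - s n \<omega>\<bar> \<partial>N) = ennreal (\<integral>\<omega>. \<bar>f \<omega> - s n \<omega>\<bar> \<partial>N)" for n
      using lim by (intro nn_integral_eq_integral) auto
    ultimately show "(\<lambda>n. \<integral>\<^sup>+\<omega>. ennreal \<bar>f \<omega> - s n \<omega>\<bar> \<partial>N) \<longlonglongrightarrow> 0" by simp
  qed simp
qed

end

subsection \<open>Merging of predictions\<close>

text \<open>If \<open>g\<close> is within \<open>d\<close> of the constant \<open>a\<close> in mean,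
  then its integral over any event \<open>B\<close> is within \<open>d\<close> of
  \<open>a * prob B\<close>, and its total integral \<open>S\<close> is within \<open>d\<close> of
  \<open>a\<close>. The numerator of the difference is therefore at most \<open>2 * d\<close> and
  the denominator \<open>S\<close> at least \<open>a / 2\<close>, whence \<open>4 * d / a\<close>.
  The bound does not depend on the event.\<close>

lemma normalized_density_close:
  fixes f :: "'b \<Rightarrow> ennreal" and g :: "'b \<Rightarrow> real"
  assumes "prob_space k" and [measurable]: "f \<in> borel_measurable k" "g \<in> borel_measurable k"
    and fg: "AE \<omega> in k. f \<omega> = ennreal (g \<omega>)" and g0: "\<And>\<omega>. 0 \<le> g \<omega>"
    and a: "0 < a" and d: "(\<integral>\<^sup>+\<omega>. ennreal \<bar>g \<omega> - a\<bar> \<partial>k) \<le> ennreal d" "0 \<le> d" "d \<le> a / 2"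
    and A [measurable]: "A \<in> sets k"
  shows "\<bar>measure (density k (\<lambda>\<omega>. f \<omega> / (\<integral>\<^sup>+\<omega>'. f \<omega>' \<partial>k))) A - measure k A\<bar> \<le> 4 * d / a"
proof -
  interpret prob_space k by fact
  have int_diff: "integrable k (\<lambda>\<omega>. g \<omega> - a)"
    using d(1) by (intro integrableI_bounded) (auto intro: le_less_trans)
  have "integrable k (\<lambda>\<omega>. (g \<omega> - a) + a)" using int_diff by (intro Bochner_Integration.integrable_add) auto
  then have int [simp]: "integrable k g" by simp
  have diff_le: "(\<integral>\<omega>. \<bar>g \<omega> - a\<bar> \<partial>k) \<le> d"
  proof -
    have "ennreal (\<integral>\<omega>. \<bar>g \<omega> - a\<bar> \<partial>k) \<le> ennreal d"
      using d(1) int_diff by (subst nn_integral_eq_integral[symmetric]) auto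
    then show ?thesis using d(2) by (simp add: ennreal_le_iff)
  qed
  define S where "S = (\<integral>\<omega>. g \<omega> \<partial>k)"
  have close: "\<bar>(\<integral>\<omega>. indicator B \<omega> * g \<omega> \<partial>k) - a * prob B\<bar> \<le> d" if [measurable]: "B \<in> events" for B
  proof -
    have "(\<integral>\<omega>. indicator B \<omega> * g \<omega> \<partial>k) - a * prob B = (\<integral>\<omega>. indicator B \<omega> * (g \<omega> - a) \<partial>k)"
      using integrable_mult_indicator[OF that int]
      by (subst right_diff_distrib, subst Bochner_Integration.integral_diff) (auto simp: emeasure_eq_measure)
    also have "\<bar>\<dots>\<bar> \<le> (\<integral>\<omega>. \<bar>indicator B \<omega> * (g \<omega> - a)\<bar> \<partial>k)"
      by (rule integral_abs_bound)
    also have "\<dots> \<le> (\<integral>\<omega>. \<bar>g \<omega> - a\<bar> \<partial>k)"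
      using int_diff integrable_mult_indicator[OF that int_diff]
      by (intro integral_mono) (auto simp: indicator_def)
    finally show ?thesis using diff_le by linarith
  qed
  have "S = (\<integral>\<omega>. indicator (space k) \<omega> * g \<omega> \<partial>k)"
    unfolding S_def by (intro Bochner_Integration.integral_cong) auto
  then have Sa: "\<bar>S - a\<bar> \<le> d" using close[of "space k"] by (simp add: prob_space)
  then have S: "a / 2 \<le> S" "0 < S" using d(3) a by linarith+
  have Sf: "(\<integral>\<^sup>+\<omega>. f \<omega> \<partial>k) = ennreal S"
    unfolding S_def using fg g0 by (subst nn_integral_eq_integral[symmetric]) (auto intro!: nn_integral_cong_AE)
  have "emeasure (density k (\<lambda>\<omega>. f \<omega> / (\<integral>\<^sup>+\<omega>'. f \<omega>' \<partial>k))) A = (\<integral>\<^sup>+\<omega>. ennreal (indicator A \<omega> * g \<omega> / S) \<partial>k)"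
    unfolding Sf using fg S(2) g0
    by (subst emeasure_density)
       (auto intro!: nn_integral_cong_AE simp: indicator_def divide_ennreal)
  also have "\<dots> = ennreal ((\<integral>\<omega>. indicator A \<omega> * g \<omega> \<partial>k) / S)"
    using integrable_mult_indicator[OF A int] g0 S(2)
    by (subst nn_integral_eq_integral) auto
  finally have "measure (density k (\<lambda>\<omega>. f \<omega> / (\<integral>\<^sup>+\<omega>'. f \<omega>' \<partial>k))) A = (\<integral>\<omega>. indicator A \<omega> * g \<omega> \<partial>k) / S"
    using g0 S(2) by (auto simp: measure_def intro!: enn2real_ennreal divide_nonneg_nonneg integral_nonneg_AE)
  then have "measure (density k (\<lambda>\<omega>. f \<omega> / (\<integral>\<^sup>+\<omega>'. f \<omega>' \<partial>k))) A - prob A =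
      ((\<integral>\<omega>. indicator A \<omega> * g \<omega> \<partial>k) - S * prob A) / S"
    using S(2) by (simp add: field_simps)
  then have "\<bar>measure (density k (\<lambda>\<omega>. f \<omega> / (\<integral>\<^sup>+\<omega>'. f \<omega>' \<partial>k))) A - prob A\<bar> =
      \<bar>(\<integral>\<omega>. indicator A \<omega> * g \<omega> \<partial>k) - S * prob A\<bar> / S"
    using S(2) by simp
  also have "\<dots> \<le> (2 * d) / S"
  proof (intro divide_right_mono)
    have "(\<integral>\<omega>. indicator A \<omega> * g \<omega> \<partial>k) - S * prob A = ((\<integral>\<omega>. indicator A \<omega> * g \<omega> \<partial>k) - a * prob A) - (S - a) * prob A"
      by (simp add: algebra_simps)
    also have "\<bar>\<dots>\<bar> \<le> \<bar>(\<integral>\<omega>. indicator A \<omega> * g \<omega> \<partial>k) - a * prob A\<bar> + \<bar>S - a\<bar> * prob A"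
      by (rule order_trans[OF abs_triangle_ineq4]) (simp add: abs_mult)
    also have "\<dots> \<le> d + d * 1"
      using Sa d(2) by (intro add_mono mult_mono close) auto
    finally show "\<bar>(\<integral>\<omega>. indicator A \<omega> * g \<omega> \<partial>k) - S * prob A\<bar> \<le> 2 * d" by simp
  qed (use S in simp)
  also have "\<dots> \<le> (2 * d) / (a / 2)"
    using S a d(2) by (intro divide_left_mono) auto
  finally show ?thesis by simp
qed

lemma ennreal_le_limit_frequently:
  fixes f g :: "nat \<Rightarrow> ennreal"
  assumes "f \<longlonglongrightarrow> a" "g \<longlonglongrightarrow> b" "\<exists>\<^sub>F n in sequentially. f n \<le> g n"
  shows "a \<le> b"
proof (rule ccontr)
  assume "\<not> a \<le> b"
  then obtain c where c: "b < c" "c < a" using dense not_le by metis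
  have "\<forall>\<^sub>F n in sequentially. \<not> f n \<le> g n"
    using order_tendstoD(1)[OF assms(1) c(2)] order_tendstoD(2)[OF assms(2) c(1)]
    by eventually_elim auto
  then show False using assms(3) by (simp add: frequently_def)
qed

context filtered_prob_space
begin

text \<open>The density may be infinite on a null set, while oscillation is defined for real
  functions. By \<open>AE_cond\<close> the real-valued version agrees with the density almost
  everywhere under the conditional distributions too, not merely under \<open>N\<close>.\<close>

lemma density_lebesgue_points:
  assumes f [measurable]: "f \<in> borel_measurable N" and fin: "(\<integral>\<^sup>+\<omega>. f \<omega> \<partial>N) \<noteq> \<infinity>"
  shows "AE \<omega> in N. f \<omega> = ennreal (enn2real (f \<omega>)) \<and>
    (\<forall>l. AE \<omega>' in cond l \<omega>. f \<omega>' = ennreal (enn2real (f \<omega>'))) \<and>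
    (\<lambda>l. osc (\<lambda>\<omega>. enn2real (f \<omega>)) l \<omega>) \<longlonglongrightarrow> 0"
proof -
  have eq: "AE \<omega> in N. f \<omega> = ennreal (enn2real (f \<omega>))"
    using nn_integral_PInf_AE[OF f fin] by eventually_elim (auto simp: top.not_eq_extremum)
  then have "(\<integral>\<^sup>+\<omega>. ennreal (enn2real (f \<omega>)) \<partial>N) = (\<integral>\<^sup>+\<omega>. f \<omega> \<partial>N)"
    by (intro nn_integral_cong_AE) auto
  then have "integrable N (\<lambda>\<omega>. enn2real (f \<omega>))"
    using fin by (intro integrableI_bounded) (auto simp: top.not_eq_extremum)
  then have "AE \<omega> in N. (\<lambda>l. osc (\<lambda>\<omega>. enn2real (f \<omega>)) l \<omega>) \<longlonglongrightarrow> 0"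
    using integrable_imp_lebesgue_regular by (auto simp: lebesgue_regular_def)
  with eq AE_cond[OF eq] show ?thesis by eventually_elim auto
qed

text \<open>At a Lebesgue point the conditional mean differs from \<open>f \<omega>\<close> by at
  most \<open>osc\<close>. The two bounds are stated separately because subtraction in
  \<open>ennreal\<close> is truncated.\<close>

lemma Levy_upward:
  assumes f [measurable]: "f \<in> borel_measurable N" and fin: "(\<integral>\<^sup>+\<omega>. f \<omega> \<partial>N) \<noteq> \<infinity>"
  shows "AE \<omega> in N. (\<lambda>l. \<integral>\<^sup>+\<omega>'. f \<omega>' \<partial>cond l \<omega>) \<longlonglongrightarrow> f \<omega>"
  using density_lebesgue_points[OF assms] AE_space
proof eventually_elim
  case (elim \<omega>)
  define g where "g \<omega> = enn2real (f \<omega>)" for \<omega>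
  have f\<omega>: "f \<omega> = ennreal (g \<omega>)" and osc: "(\<lambda>l. osc g l \<omega>) \<longlonglongrightarrow> 0"
    using elim unfolding g_def by auto
  have [measurable]: "g \<in> borel_measurable N" unfolding g_def by measurable
  have bounds: "(\<integral>\<^sup>+\<omega>'. f \<omega>' \<partial>cond l \<omega>) \<le> osc g l \<omega> + f \<omega>" "f \<omega> - osc g l \<omega> \<le> (\<integral>\<^sup>+\<omega>'. f \<omega>' \<partial>cond l \<omega>)" for l
  proof -
    interpret c: prob_space "cond l \<omega>" by (rule cond_props[OF elim(2)])
    note [measurable] = borel_cond[OF elim(2), of g l]
    have int: "(\<integral>\<^sup>+\<omega>'. f \<omega>' \<partial>cond l \<omega>) = (\<integral>\<^sup>+\<omega>'. ennreal (g \<omega>') \<partial>cond l \<omega>)"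
      using elim(1) unfolding g_def by (intro nn_integral_cong_AE) auto
    also have "\<dots> \<le> (\<integral>\<^sup>+\<omega>'. ennreal \<bar>g \<omega>' - g \<omega>\<bar> + ennreal (g \<omega>) \<partial>cond l \<omega>)"
      by (intro nn_integral_mono) (simp add: ennreal_plus[symmetric] g_def del: ennreal_plus)
    also have "\<dots> = osc g l \<omega> + f \<omega>"
      unfolding osc_def f\<omega> by (simp add: nn_integral_add c.emeasure_space_1)
    finally show "(\<integral>\<^sup>+\<omega>'. f \<omega>' \<partial>cond l \<omega>) \<le> osc g l \<omega> + f \<omega>" .
    have "f \<omega> = (\<integral>\<^sup>+\<omega>'. ennreal (g \<omega>) \<partial>cond l \<omega>)"
      by (simp add: c.emeasure_space_1 f\<omega>)
    also have "\<dots> \<le> (\<integral>\<^sup>+\<omega>'. ennreal \<bar>g \<omega>' - g \<omega>\<bar> + ennreal (g \<omega>') \<partial>cond l \<omega>)"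
      by (intro nn_integral_mono) (simp add: ennreal_plus[symmetric] g_def del: ennreal_plus)
    also have "\<dots> = osc g l \<omega> + (\<integral>\<^sup>+\<omega>'. f \<omega>' \<partial>cond l \<omega>)"
      unfolding osc_def int by (simp add: nn_integral_add)
    finally show "f \<omega> - osc g l \<omega> \<le> (\<integral>\<^sup>+\<omega>'. f \<omega>' \<partial>cond l \<omega>)"
      using f\<omega> by (subst ennreal_minus_le_iff) (auto simp: add.commute)
  qed
  have "(\<lambda>l. osc g l \<omega> + f \<omega>) \<longlonglongrightarrow> 0 + f \<omega>" by (rule tendsto_add[OF osc tendsto_const])
  moreover have "(\<lambda>l. f \<omega> - osc g l \<omega>) \<longlonglongrightarrow> f \<omega> - 0"
    by (rule tendsto_diff_ennreal[OF tendsto_const osc]) (simp_all add: f\<omega>)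
  ultimately show ?case
    using tendsto_sandwich[of "\<lambda>l. f \<omega> - osc g l \<omega>" "\<lambda>l. \<integral>\<^sup>+\<omega>'. f \<omega>' \<partial>cond l \<omega>" sequentially
        "\<lambda>l. osc g l \<omega> + f \<omega>" "f \<omega>"] bounds by simp
qed

text \<open>\<open>Q\<close>-almost every point has positive density, and at a Lebesgue point the
  density and its normalisation are both close to this one positive number. The comparison with
  \<open>cond l \<omega>\<close>, which does not depend on \<open>Q\<close>, later allows two models
  to be compared by the triangle inequality.\<close>

lemma predictive_close_kernel:
  assumes f [measurable]: "f \<in> borel_measurable N" and Q: "density N f = Q" "prob_space Q"
    and C: "\<And>l. AE x in marginal X l Q. C l x = density (k l x) (\<lambda>\<omega>. f \<omega> / (\<integral>\<^sup>+\<omega>'. f \<omega>' \<partial>k l x))"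
  shows "AE \<omega> in Q. \<forall>\<epsilon>>0. \<forall>\<^sub>F l in sequentially. \<forall>A\<in>sets (seq_space X).
    \<bar>measure (C l (initial l \<omega>)) A - measure (cond l \<omega>) A\<bar> \<le> \<epsilon>"
proof -
  have sets_Q: "sets Q = sets (seq_space X)" using sets_N unfolding Q(1)[symmetric] by simp
  have "(\<integral>\<^sup>+\<omega>. f \<omega> \<partial>N) = emeasure Q (space Q)"
    unfolding Q(1)[symmetric] by (simp add: emeasure_density cong: nn_integral_cong)
  then have fin: "(\<integral>\<^sup>+\<omega>. f \<omega> \<partial>N) \<noteq> \<infinity>"
    using prob_space.emeasure_space_1[OF Q(2)] by simp
  have "AE \<omega> in Q. \<forall>l. C l (initial l \<omega>) = density (cond l \<omega>) (\<lambda>\<omega>'. f \<omega>' / (\<integral>\<^sup>+\<omega>'. f \<omega>' \<partial>cond l \<omega>))"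
    unfolding AE_all_countable using AE_marginalD[OF sets_Q C] by auto
  then have "AE \<omega> in N. 0 < f \<omega> \<longrightarrow> (\<forall>l. C l (initial l \<omega>) = density (cond l \<omega>) (\<lambda>\<omega>'. f \<omega>' / (\<integral>\<^sup>+\<omega>'. f \<omega>' \<partial>cond l \<omega>)))"
    unfolding Q(1)[symmetric] by (simp add: AE_density)
  with density_lebesgue_points[OF f fin] AE_space
  have "AE \<omega> in N. 0 < f \<omega> \<longrightarrow> (\<forall>\<epsilon>>0. \<forall>\<^sub>F l in sequentially. \<forall>A\<in>sets (seq_space X).
    \<bar>measure (C l (initial l \<omega>)) A - measure (cond l \<omega>) A\<bar> \<le> \<epsilon>)"
  proof (eventually_elim, intro impI allI)
    fix \<omega> and \<epsilon> :: real
    assume 1: "f \<omega> = ennreal (enn2real (f \<omega>)) \<and>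
      (\<forall>l. AE \<omega>' in cond l \<omega>. f \<omega>' = ennreal (enn2real (f \<omega>'))) \<and>
      (\<lambda>l. osc (\<lambda>\<omega>. enn2real (f \<omega>)) l \<omega>) \<longlonglongrightarrow> 0"
      and 2: "\<omega> \<in> space N"
      and 3: "0 < f \<omega> \<longrightarrow> (\<forall>l. C l (initial l \<omega>) = density (cond l \<omega>) (\<lambda>\<omega>'. f \<omega>' / (\<integral>\<^sup>+\<omega>'. f \<omega>' \<partial>cond l \<omega>)))"
      and pos: "0 < f \<omega>" and \<epsilon>: "0 < \<epsilon>"
    define a where "a = enn2real (f \<omega>)"
    have a: "0 < a" using 1 pos unfolding a_def by (metis enn2real_nonneg ennreal_0 less_eq_real_def less_irrefl)
    \<comment> \<open>The first bound is required by \<open>normalized_density_close\<close>, the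
      second turns its conclusion \<open>4 * d / a\<close> into at most
      \<open>\<epsilon>\<close>.\<close>
    define d where "d = min (a / 2) (\<epsilon> * a / 4)"
    have d: "0 < d" "d \<le> a / 2" "4 * d / a \<le> \<epsilon>"
      using a \<epsilon> by (auto simp: d_def field_simps min_def)
    have "\<forall>\<^sub>F l in sequentially. osc (\<lambda>\<omega>. enn2real (f \<omega>)) l \<omega> < ennreal d"
      using 1 d(1) by (intro order_tendstoD) auto
    then show "\<forall>\<^sub>F l in sequentially. \<forall>A\<in>sets (seq_space X).
        \<bar>measure (C l (initial l \<omega>)) A - measure (cond l \<omega>) A\<bar> \<le> \<epsilon>"
    proof (eventually_elim, intro ballI)
      fix l A assume l: "osc (\<lambda>\<omega>. enn2real (f \<omega>)) l \<omega> < ennreal d" and A: "A \<in> sets (seq_space X)"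
      have "\<bar>measure (C l (initial l \<omega>)) A - measure (cond l \<omega>) A\<bar> \<le> 4 * d / a"
        unfolding 3[rule_format, OF pos]
      proof (rule normalized_density_close[where g = "\<lambda>\<omega>. enn2real (f \<omega>)"])
        show "(\<integral>\<^sup>+\<omega>'. ennreal \<bar>enn2real (f \<omega>') - a\<bar> \<partial>cond l \<omega>) \<le> ennreal d"
          using l unfolding osc_def a_def by simp
      qed (use 1 a d A cond_props[OF 2] borel_cond[OF 2 f] in auto)
      then show "\<bar>measure (C l (initial l \<omega>)) A - measure (cond l \<omega>) A\<bar> \<le> \<epsilon>"
        using d(3) by linarith
    qed
  qed
  then show ?thesis unfolding Q(1)[symmetric] by (simp add: AE_density)
qed

text \<open>Domination on all subsets of \<open>E l\<close> localises to an inequality between the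
  conditional means of the two densities, almost everywhere on \<open>E l\<close>. The means
  converge to the densities, so an inequality at infinitely many lengths yields
  \<open>c * fP \<omega> \<le> fQ \<omega>\<close> in the limit.\<close>

lemma density_positive_if_frequently_dominating:
  assumes [measurable]: "fP \<in> borel_measurable N" "fQ \<in> borel_measurable N"
    and P: "density N fP = P" "prob_space P" and Q: "density N fQ = Q" "prob_space Q"
    and c: "0 < c" "c < \<top>"
    and E [measurable]: "\<And>l. E l \<in> sets (string_space X l)"
    and dom: "\<And>l D. D \<in> sets (string_space X l) \<Longrightarrow> D \<subseteq> E l \<Longrightarrow>
      c * emeasure P (cylinder X l D) \<le> emeasure Q (cylinder X l D)"
  shows "AE \<omega> in N. 0 < fP \<omega> \<longrightarrow> (\<exists>\<^sub>F l in sequentially. initial l \<omega> \<in> E l) \<longrightarrow> 0 < fQ \<omega>"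
proof -
  have fin: "(\<integral>\<^sup>+\<omega>. fP \<omega> \<partial>N) \<noteq> \<infinity>" "(\<integral>\<^sup>+\<omega>. fQ \<omega> \<partial>N) \<noteq> \<infinity>"
    using prob_space.emeasure_space_1[OF P(2)] prob_space.emeasure_space_1[OF Q(2)]
    unfolding P(1)[symmetric] Q(1)[symmetric] by (simp_all add: emeasure_density cong: nn_integral_cong)
  note [measurable] = measurable_nn_integral_kernel[of fP] measurable_nn_integral_kernel[of fQ]
  have le: "AE x in marginal X l N. x \<in> E l \<longrightarrow> c * (\<integral>\<^sup>+\<omega>. fP \<omega> \<partial>k l x) \<le> (\<integral>\<^sup>+\<omega>. fQ \<omega> \<partial>k l x)" for l
  proof (rule ccontr)
    assume neg: "\<not> ?thesis"
    \<comment> \<open>The strings that violate the inequality. If they had positive measure, strict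
      comparison of integrals over \<open>D\<close> would contradict \<open>dom\<close> for
      \<open>D\<close> itself; finiteness of \<open>Q\<close> makes the comparison strict.\<close>
    define D where "D = {x\<in>E l. (\<integral>\<^sup>+\<omega>. fQ \<omega> \<partial>k l x) < c * (\<integral>\<^sup>+\<omega>. fP \<omega> \<partial>k l x)}"
    have "D = {x\<in>space (string_space X l). x \<in> E l \<and> (\<integral>\<^sup>+\<omega>. fQ \<omega> \<partial>k l x) < c * (\<integral>\<^sup>+\<omega>. fP \<omega> \<partial>k l x)}"
      using sets.sets_into_space[OF E] by (auto simp: D_def)
    also have "\<dots> \<in> sets (string_space X l)" by measurable
    finally have D [measurable]: "D \<in> sets (string_space X l)" .
    have Q_D: "(\<integral>\<^sup>+x\<in>D. (\<integral>\<^sup>+\<omega>. fQ \<omega> \<partial>k l x) \<partial>marginal X l N) = emeasure Q (cylinder X l D)"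
      unfolding Q(1)[symmetric] by (simp add: nn_integral_kernel emeasure_density)
    have P_D: "(\<integral>\<^sup>+x\<in>D. c * (\<integral>\<^sup>+\<omega>. fP \<omega> \<partial>k l x) \<partial>marginal X l N) = c * emeasure P (cylinder X l D)"
      unfolding P(1)[symmetric]
      by (simp add: nn_integral_kernel emeasure_density nn_integral_cmult mult.assoc)
    have "(\<integral>\<^sup>+x\<in>D. (\<integral>\<^sup>+\<omega>. fQ \<omega> \<partial>k l x) \<partial>marginal X l N) < (\<integral>\<^sup>+x\<in>D. c * (\<integral>\<^sup>+\<omega>. fP \<omega> \<partial>k l x) \<partial>marginal X l N)"
    proof (rule nn_integral_less)
      show "(\<integral>\<^sup>+x\<in>D. (\<integral>\<^sup>+\<omega>. fQ \<omega> \<partial>k l x) \<partial>marginal X l N) \<noteq> \<infinity>"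
        unfolding Q_D using prob_space.finite_measure[OF Q(2)] by (simp add: finite_measure.emeasure_finite)
      show "AE x in marginal X l N. (\<integral>\<^sup>+\<omega>. fQ \<omega> \<partial>k l x) * indicator D x \<le> c * (\<integral>\<^sup>+\<omega>. fP \<omega> \<partial>k l x) * indicator D x"
        by (auto simp: D_def indicator_def)
      show "\<not> (AE x in marginal X l N. c * (\<integral>\<^sup>+\<omega>. fP \<omega> \<partial>k l x) * indicator D x \<le> (\<integral>\<^sup>+\<omega>. fQ \<omega> \<partial>k l x) * indicator D x)"
      proof
        assume "AE x in marginal X l N. c * (\<integral>\<^sup>+\<omega>. fP \<omega> \<partial>k l x) * indicator D x \<le> (\<integral>\<^sup>+\<omega>. fQ \<omega> \<partial>k l x) * indicator D x"
        then have "AE x in marginal X l N. x \<in> E l \<longrightarrow> c * (\<integral>\<^sup>+\<omega>. fP \<omega> \<partial>k l x) \<le> (\<integral>\<^sup>+\<omega>. fQ \<omega> \<partial>k l x)"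
        proof eventually_elim
          case (elim x)
          then show ?case by (cases "x \<in> D") (auto simp: D_def not_less)
        qed
        then show False using neg by simp
      qed
    qed measurable
    then show False
      unfolding Q_D P_D using dom[OF D] by (auto simp: D_def)
  qed
  have "AE \<omega> in N. \<forall>l. initial l \<omega> \<in> E l \<longrightarrow> c * (\<integral>\<^sup>+\<omega>'. fP \<omega>' \<partial>cond l \<omega>) \<le> (\<integral>\<^sup>+\<omega>'. fQ \<omega>' \<partial>cond l \<omega>)"
    unfolding AE_all_countable using AE_marginalD[OF sets_N le] by auto
  moreover have "AE \<omega> in N. (\<lambda>l. \<integral>\<^sup>+\<omega>'. fP \<omega>' \<partial>cond l \<omega>) \<longlonglongrightarrow> fP \<omega>"
    "AE \<omega> in N. (\<lambda>l. \<integral>\<^sup>+\<omega>'. fQ \<omega>' \<partial>cond l \<omega>) \<longlonglongrightarrow> fQ \<omega>"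
    using fin by (auto intro: Levy_upward)
  ultimately show ?thesis
  proof (eventually_elim, intro impI)
    fix \<omega>
    assume dom: "\<forall>l. initial l \<omega> \<in> E l \<longrightarrow> c * (\<integral>\<^sup>+\<omega>'. fP \<omega>' \<partial>cond l \<omega>) \<le> (\<integral>\<^sup>+\<omega>'. fQ \<omega>' \<partial>cond l \<omega>)"
      and lim: "(\<lambda>l. \<integral>\<^sup>+\<omega>'. fP \<omega>' \<partial>cond l \<omega>) \<longlonglongrightarrow> fP \<omega>" "(\<lambda>l. \<integral>\<^sup>+\<omega>'. fQ \<omega>' \<partial>cond l \<omega>) \<longlonglongrightarrow> fQ \<omega>"
      and pos: "0 < fP \<omega>" and freq: "\<exists>\<^sub>F l in sequentially. initial l \<omega> \<in> E l"
    have "\<exists>\<^sub>F l in sequentially. c * (\<integral>\<^sup>+\<omega>'. fP \<omega>' \<partial>cond l \<omega>) \<le> (\<integral>\<^sup>+\<omega>'. fQ \<omega>' \<partial>cond l \<omega>)"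
      using freq by (rule frequently_elim1) (use dom in blast)
    then have "c * fP \<omega> \<le> fQ \<omega>"
      by (rule ennreal_le_limit_frequently[OF ennreal_tendsto_cmult[OF c(2) lim(1)] lim(2)])
    moreover have "0 < c * fP \<omega>" using c(1) pos by (simp add: ennreal_zero_less_mult_iff)
    ultimately show "0 < fQ \<omega>" by simp
  qed
qed

end

text \<open>
  A form of the Blackwell--Dubins theorem. The sets \<open>E l\<close> play the role of the strings where the
  likelihood ratio of \<open>Q\<close> to \<open>P\<close> is at least \<open>c\<close>.
\<close>

lemma predictive_merging:
  assumes cons: "consistent_conditionals X {P, Q} C"
    and P: "prob_space P" "sets P = sets (seq_space X)" and Q: "prob_space Q" "sets Q = sets (seq_space X)"
    and c: "0 < c" "c < \<top>"
    and E: "\<And>l. E l \<in> sets (string_space X l)"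
    and dom: "\<And>l D. D \<in> sets (string_space X l) \<Longrightarrow> D \<subseteq> E l \<Longrightarrow>
      c * emeasure P (cylinder X l D) \<le> emeasure Q (cylinder X l D)"
  shows "AE \<omega> in P. (\<exists>\<^sub>F l in sequentially. initial l \<omega> \<in> E l) \<longrightarrow>
    (\<forall>\<epsilon>>0. \<forall>\<^sub>F l in sequentially. \<forall>A\<in>sets (seq_space X).
      \<bar>measure (C Q l (initial l \<omega>)) A - measure (C P l (initial l \<omega>)) A\<bar> \<le> \<epsilon>)"
proof -
  obtain N k f where *: "prob_space N \<and> sets N = sets (seq_space X) \<and>
      (\<forall>l. regular_conditional X N l (k l)) \<and>
      (\<forall>Q\<in>{P, Q}. f Q \<in> borel_measurable (seq_space X) \<and> density N (f Q) = Q) \<and>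
      (\<forall>Q\<in>{P, Q}. \<forall>l. AE x in marginal X l Q.
         C Q l x = density (k l x) (\<lambda>\<omega>. f Q \<omega> / (\<integral>\<^sup>+\<omega>'. f Q \<omega>' \<partial>k l x)))"
    using cons unfolding consistent_conditionals_def by (elim exE) (rule that)
  then have N: "prob_space N" "sets N = sets (seq_space X)" "\<And>l. regular_conditional X N l (k l)"
    and f: "f P \<in> borel_measurable (seq_space X)" "f Q \<in> borel_measurable (seq_space X)"
      "density N (f P) = P" "density N (f Q) = Q"
    and C: "\<And>l. AE x in marginal X l P. C P l x = density (k l x) (\<lambda>\<omega>. f P \<omega> / (\<integral>\<^sup>+\<omega>'. f P \<omega>' \<partial>k l x))"
      "\<And>l. AE x in marginal X l Q. C Q l x = density (k l x) (\<lambda>\<omega>. f Q \<omega> / (\<integral>\<^sup>+\<omega>'. f Q \<omega>' \<partial>k l x))"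
    by simp_all
  interpret N: filtered_prob_space N X k
    using N by (intro filtered_prob_space.intro filtered_prob_space_axioms.intro) auto
  have f_N: "f P \<in> borel_measurable N" "f Q \<in> borel_measurable N"
    using f by (simp_all add: N.borel_N)
  have "AE \<omega> in density N (f P). \<forall>\<epsilon>>0. \<forall>\<^sub>F l in sequentially. \<forall>A\<in>sets (seq_space X).
      \<bar>measure (C P l (initial l \<omega>)) A - measure (N.cond l \<omega>) A\<bar> \<le> \<epsilon>"
    unfolding f(3) using N.predictive_close_kernel[OF f_N(1) f(3) P(1) C(1)] .
  moreover have "AE \<omega> in density N (f Q). \<forall>\<epsilon>>0. \<forall>\<^sub>F l in sequentially. \<forall>A\<in>sets (seq_space X).
      \<bar>measure (C Q l (initial l \<omega>)) A - measure (N.cond l \<omega>) A\<bar> \<le> \<epsilon>"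
    unfolding f(4) using N.predictive_close_kernel[OF f_N(2) f(4) Q(1) C(2)] .
  \<comment> \<open>This moves the statement about \<open>Q\<close> to \<open>P\<close>: the
    preceding fact is usable only where \<open>f Q\<close> is positive.\<close>
  moreover have "AE \<omega> in N. 0 < f P \<omega> \<longrightarrow> (\<exists>\<^sub>F l in sequentially. initial l \<omega> \<in> E l) \<longrightarrow> 0 < f Q \<omega>"
    by (rule N.density_positive_if_frequently_dominating[OF f_N f(3) P(1) f(4) Q(1) c E dom])
  ultimately have "AE \<omega> in N. 0 < f P \<omega> \<longrightarrow> (\<exists>\<^sub>F l in sequentially. initial l \<omega> \<in> E l) \<longrightarrow>
    (\<forall>\<epsilon>>0. \<forall>\<^sub>F l in sequentially. \<forall>A\<in>sets (seq_space X).
      \<bar>measure (C Q l (initial l \<omega>)) A - measure (C P l (initial l \<omega>)) A\<bar> \<le> \<epsilon>)"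
    unfolding AE_density[OF f_N(1)] AE_density[OF f_N(2)]
  proof (eventually_elim, intro impI allI)
    fix \<omega> and \<epsilon> :: real
    assume CP: "0 < f P \<omega> \<longrightarrow> (\<forall>\<epsilon>>0. \<forall>\<^sub>F l in sequentially. \<forall>A\<in>sets (seq_space X).
        \<bar>measure (C P l (initial l \<omega>)) A - measure (N.cond l \<omega>) A\<bar> \<le> \<epsilon>)"
      and CQ: "0 < f Q \<omega> \<longrightarrow> (\<forall>\<epsilon>>0. \<forall>\<^sub>F l in sequentially. \<forall>A\<in>sets (seq_space X).
        \<bar>measure (C Q l (initial l \<omega>)) A - measure (N.cond l \<omega>) A\<bar> \<le> \<epsilon>)"
      and pos: "0 < f P \<omega> \<longrightarrow> (\<exists>\<^sub>F l in sequentially. initial l \<omega> \<in> E l) \<longrightarrow> 0 < f Q \<omega>"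
      "0 < f P \<omega>" "\<exists>\<^sub>F l in sequentially. initial l \<omega> \<in> E l"
      and "0 < \<epsilon>"
    then have "0 < \<epsilon> / 2" by simp
    have "\<forall>\<^sub>F l in sequentially. \<forall>A\<in>sets (seq_space X). \<bar>measure (C P l (initial l \<omega>)) A - measure (N.cond l \<omega>) A\<bar> \<le> \<epsilon> / 2"
      using CP pos(2) \<open>0 < \<epsilon> / 2\<close> by blast
    moreover have "\<forall>\<^sub>F l in sequentially. \<forall>A\<in>sets (seq_space X). \<bar>measure (C Q l (initial l \<omega>)) A - measure (N.cond l \<omega>) A\<bar> \<le> \<epsilon> / 2"
      using CQ pos \<open>0 < \<epsilon> / 2\<close> by blast
    ultimately show "\<forall>\<^sub>F l in sequentially. \<forall>A\<in>sets (seq_space X).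
      \<bar>measure (C Q l (initial l \<omega>)) A - measure (C P l (initial l \<omega>)) A\<bar> \<le> \<epsilon>"
    proof (eventually_elim, intro ballI)
      fix l A
      assume le: "\<forall>A\<in>sets (seq_space X). \<bar>measure (C P l (initial l \<omega>)) A - measure (N.cond l \<omega>) A\<bar> \<le> \<epsilon> / 2"
        "\<forall>A\<in>sets (seq_space X). \<bar>measure (C Q l (initial l \<omega>)) A - measure (N.cond l \<omega>) A\<bar> \<le> \<epsilon> / 2"
        and A: "A \<in> sets (seq_space X)"
      from le(1)[rule_format, OF A] le(2)[rule_format, OF A]
      show "\<bar>measure (C Q l (initial l \<omega>)) A - measure (C P l (initial l \<omega>)) A\<bar> \<le> \<epsilon>"
        unfolding abs_le_iff by linarith
    qed
  qed
  then have "AE \<omega> in density N (f P). (\<exists>\<^sub>F l in sequentially. initial l \<omega> \<in> E l) \<longrightarrow>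
    (\<forall>\<epsilon>>0. \<forall>\<^sub>F l in sequentially. \<forall>A\<in>sets (seq_space X).
      \<bar>measure (C Q l (initial l \<omega>)) A - measure (C P l (initial l \<omega>)) A\<bar> \<le> \<epsilon>)"
    unfolding AE_density[OF f_N(1)] .
  then show ?thesis unfolding f(3) .
qed

subsection \<open>Consistency from almost sure uniqueness\<close>

lemma regular_conditionalI:
  assumes "\<And>x. x \<in> space (string_space X l) \<Longrightarrow> prob_space (k x)"
    and "\<And>x. x \<in> space (string_space X l) \<Longrightarrow> sets (k x) = sets (seq_space X)"
    and "\<And>A. A \<in> sets (seq_space X) \<Longrightarrow> (\<lambda>x. emeasure (k x) A) \<in> borel_measurable (string_space X l)"
    and "\<And>A B. A \<in> sets (seq_space X) \<Longrightarrow> B \<in> sets (string_space X l) \<Longrightarrow>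
      (\<integral>\<^sup>+x\<in>B. emeasure (k x) A \<partial>marginal X l Q) = emeasure Q (A \<inter> cylinder X l B)"
  shows "regular_conditional X Q l k"
proof -
  have "k \<in> string_space X l \<rightarrow>\<^sub>M prob_algebra (seq_space X)"
    using assms by (intro measurable_prob_algebraI measurable_subprob_algebra)
      (auto intro: prob_space_imp_subprob_space)
  then show ?thesis
    using assms(4) by (simp add: regular_conditional_def cylinder_def)
qed

lemma regular_conditional_emeasure:
  assumes "regular_conditional X Q l k" "A \<in> sets (seq_space X)"
  shows "(\<lambda>x. emeasure (k x) A) \<in> borel_measurable (string_space X l)"
proof -
  have "k \<in> string_space X l \<rightarrow>\<^sub>M prob_algebra (seq_space X)"
    using assms(1) by (simp add: regular_conditional_def)
  from measurable_compose[OF measurable_prob_algebraD[OF this] measurable_emeasure_subprob_algebra[OF assms(2)]]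
  show ?thesis .
qed

lemma regular_conditional_integral:
  assumes "regular_conditional X Q l k" "A \<in> sets (seq_space X)" "B \<in> sets (string_space X l)"
  shows "(\<integral>\<^sup>+x\<in>B. emeasure (k x) A \<partial>marginal X l Q) = emeasure Q (A \<inter> cylinder X l B)"
  using assms by (simp add: regular_conditional_def cylinder_def)

context filtered_prob_space
begin

text \<open>Bayes' formula: the kernel of \<open>N\<close> reweighted by \<open>f\<close> and
  normalised is, after repair on a null set, itself a regular conditional distribution of
  \<open>Q\<close>. Uniqueness then identifies it with the given version.\<close>

lemma AE_conditional_of_density:
  assumes f [measurable]: "f \<in> borel_measurable N" and Q: "density N f = Q" "prob_space Q"
    and C: "regular_conditional X Q l C" and unique: "as_unique_conditional X Q l"
  shows "AE x in marginal X l Q. C x = density (k l x) (\<lambda>\<omega>. f \<omega> / (\<integral>\<^sup>+\<omega>'. f \<omega>' \<partial>k l x))"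
proof -
  have sets_Q: "sets Q = sets (seq_space X)" using sets_N unfolding Q(1)[symmetric] by simp
  define r where "r x = (\<integral>\<^sup>+\<omega>. f \<omega> \<partial>k l x)" for x
  have r [measurable]: "r \<in> borel_measurable (string_space X l)"
    unfolding r_def by (rule measurable_nn_integral_kernel) simp
  have "(\<integral>\<^sup>+x. r x \<partial>marginal X l N) = emeasure Q (space Q)"
    unfolding r_def nn_integral_kernel_space[OF f] Q(1)[symmetric] by (simp add: emeasure_density cong: nn_integral_cong)
  then have "AE x in marginal X l N. r x \<noteq> \<infinity>"
    using prob_space.emeasure_space_1[OF Q(2)] by (intro nn_integral_noteq_infinite) auto
  have marg: "marginal X l Q = density (marginal X l N) r"
  proof (rule measure_eqI)
    fix B assume "B \<in> sets (marginal X l Q)"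
    then have B [measurable]: "B \<in> sets (string_space X l)" by simp
    show "emeasure (marginal X l Q) B = emeasure (density (marginal X l N) r) B"
      unfolding emeasure_marginal[OF sets_Q B] unfolding Q(1)[symmetric] r_def
      using measurable_nn_integral_kernel[OF f, of l] by (simp add: emeasure_density nn_integral_kernel)
  qed simp
  \<comment> \<open>Where the normalisation is \<open>0\<close> or \<open>\<infinity>\<close> the quotient is not a probability measure; this is a \<open>Q\<close>-null set.\<close>
  define k' where "k' x = (if r x = 0 \<or> r x = \<infinity> then C x else density (k l x) (\<lambda>\<omega>. f \<omega> / r x))" for x
  have f_k: "f \<in> borel_measurable (k l x)" if "x \<in> space (string_space X l)" for x
    using regular_conditional_borel_measurable[OF regular that] f[unfolded borel_N] by blast
  have em: "emeasure (density (k l x) (\<lambda>\<omega>. f \<omega> / r x)) A = (\<integral>\<^sup>+\<omega>\<in>A. f \<omega> \<partial>k l x) / r x"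
    if x: "x \<in> space (string_space X l)" and A: "A \<in> sets (seq_space X)" for x A
  proof -
    note [measurable] = f_k[OF x]
    have [measurable]: "A \<in> sets (k l x)" using A regular_conditional_prob_space[OF regular x] by simp
    have "emeasure (density (k l x) (\<lambda>\<omega>. f \<omega> / r x)) A = (\<integral>\<^sup>+\<omega>. (f \<omega> * indicator A \<omega>) / r x \<partial>k l x)"
      by (subst emeasure_density) (auto intro!: nn_integral_cong simp: indicator_def)
    also have "\<dots> = (\<integral>\<^sup>+\<omega>\<in>A. f \<omega> \<partial>k l x) / r x"
      by (rule nn_integral_divide) simp
    finally show ?thesis .
  qed
  have "regular_conditional X Q l k'"
  proof (rule regular_conditionalI)
    fix x assume x: "x \<in> space (string_space X l)"
    show "sets (k' x) = sets (seq_space X)"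
      using regular_conditional_prob_space[OF regular x] regular_conditional_prob_space[OF C x] by (simp add: k'_def)
    show "prob_space (k' x)"
    proof (cases "r x = 0 \<or> r x = \<infinity>")
      case True then show ?thesis using regular_conditional_prob_space[OF C x] by (simp add: k'_def)
    next
      case False
      have "(\<integral>\<^sup>+\<omega>\<in>space (seq_space X). f \<omega> \<partial>k l x) = r x"
        unfolding r_def using regular_conditional_prob_space(3)[OF regular x] by (intro nn_integral_cong) auto
      then show ?thesis
        using False em[OF x, of "space (seq_space X)"] regular_conditional_prob_space(3)[OF regular x]
        by (intro prob_spaceI) (auto simp: k'_def ennreal_divide_self top.not_eq_extremum)
    qed
  next
    fix A assume A [measurable]: "A \<in> sets (seq_space X)"
    then have A_N [measurable]: "A \<in> sets N" using sets_N by simp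
    have [measurable]: "(\<lambda>x. \<integral>\<^sup>+\<omega>\<in>A. f \<omega> \<partial>k l x) \<in> borel_measurable (string_space X l)"
      by (rule measurable_nn_integral_kernel) measurable
    note [measurable] = regular_conditional_emeasure[OF C A]
    have "(\<lambda>x. if r x = 0 \<or> r x = \<infinity> then emeasure (C x) A else (\<integral>\<^sup>+\<omega>\<in>A. f \<omega> \<partial>k l x) / r x)
        \<in> borel_measurable (string_space X l)"
      by measurable
    moreover have "emeasure (k' x) A = (if r x = 0 \<or> r x = \<infinity> then emeasure (C x) A else (\<integral>\<^sup>+\<omega>\<in>A. f \<omega> \<partial>k l x) / r x)"
      if "x \<in> space (string_space X l)" for x
      by (simp add: k'_def em[OF that A])
    ultimately show [measurable]: "(\<lambda>x. emeasure (k' x) A) \<in> borel_measurable (string_space X l)"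
      by (simp cong: measurable_cong)
    fix B assume B [measurable]: "B \<in> sets (string_space X l)"
    have "(\<integral>\<^sup>+x\<in>B. emeasure (k' x) A \<partial>marginal X l Q) = (\<integral>\<^sup>+x. r x * (emeasure (k' x) A * indicator B x) \<partial>marginal X l N)"
      unfolding marg by (subst nn_integral_density) auto
    also have "\<dots> = (\<integral>\<^sup>+x\<in>B. (\<integral>\<^sup>+\<omega>\<in>A. f \<omega> \<partial>k l x) \<partial>marginal X l N)"
    proof (rule nn_integral_cong_AE)
      \<comment> \<open>The factor \<open>r x\<close>, the density of the marginal of
        \<open>Q\<close>, cancels the normalisation. Where it is \<open>0\<close>, the integral over
        \<open>A\<close> is \<open>0\<close> as well, being at most \<open>r x\<close>.\<close>
      show "AE x in marginal X l N. r x * (emeasure (k' x) A * indicator B x) = (\<integral>\<^sup>+\<omega>\<in>A. f \<omega> \<partial>k l x) * indicator B x"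
        using \<open>AE x in marginal X l N. r x \<noteq> \<infinity>\<close> AE_space
      proof eventually_elim
        case (elim x)
        have x: "x \<in> space (string_space X l)" using elim by simp
        have le: "(\<integral>\<^sup>+\<omega>\<in>A. f \<omega> \<partial>k l x) \<le> r x"
          unfolding r_def by (intro nn_integral_mono) (auto simp: indicator_def)
        show ?case
        proof (cases "r x = 0")
          case True then show ?thesis using le by simp
        next
          case False
          then have "r x * emeasure (k' x) A = (\<integral>\<^sup>+\<omega>\<in>A. f \<omega> \<partial>k l x)"
            using elim em[OF x A] by (simp add: k'_def ennreal_times_divide mult.commute[of "r x"] ennreal_mult_divide_eq)
          then show ?thesis by (simp add: mult.assoc[symmetric])
        qed
      qed
    qed
    also have "\<dots> = (\<integral>\<^sup>+\<omega>\<in>cylinder X l B. (f \<omega> * indicator A \<omega>) \<partial>N)"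
      by (rule nn_integral_kernel) measurable
    also have "\<dots> = emeasure Q (A \<inter> cylinder X l B)"
      unfolding Q(1)[symmetric] by (simp add: emeasure_density mult.assoc indicator_inter_arith)
    finally show "(\<integral>\<^sup>+x\<in>B. emeasure (k' x) A \<partial>marginal X l Q) = emeasure Q (A \<inter> cylinder X l B)" .
  qed
  then have "AE x in marginal X l Q. C x = k' x"
    using unique C unfolding as_unique_conditional_def by blast
  moreover have "AE x in marginal X l Q. r x \<noteq> 0 \<and> r x \<noteq> \<infinity>"
    unfolding marg using \<open>AE x in marginal X l N. r x \<noteq> \<infinity>\<close> by (subst AE_density) auto
  ultimately show ?thesis
    by eventually_elim (simp add: k'_def r_def)
qed

end

section \<open>Conditional distributions of a mixture of two measures\<close>

text \<open>Encoded as a random choice of the component, so that total mass and measurable sets come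
  from the laws of \<open>bind\<close>. It serves both for the dominating measure, with weight
  \<open>1 / 2\<close>, and for its kernels, with a weight depending on the string.\<close>

definition mixture :: "real \<Rightarrow> 'b measure \<Rightarrow> 'b measure \<Rightarrow> 'b measure" where
  "mixture w P Q = measure_pmf (bernoulli_pmf w) \<bind> (\<lambda>b. if b then P else Q)"

lemma mixture_properties:
  assumes w: "0 \<le> w" "w \<le> 1" and P: "prob_space P" "sets P = sets S" and Q: "prob_space Q" "sets Q = sets S"
  shows "prob_space (mixture w P Q)" "sets (mixture w P Q) = sets S"
    "A \<in> sets S \<Longrightarrow> emeasure (mixture w P Q) A = ennreal w * emeasure P A + ennreal (1 - w) * emeasure Q A"
proof -
  have kernel: "(\<lambda>b. if b then P else Q) \<in> measure_pmf (bernoulli_pmf w) \<rightarrow>\<^sub>M prob_algebra S"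
    using P Q by (auto simp: space_prob_algebra)
  have pmf: "measure_pmf (bernoulli_pmf w) \<in> space (prob_algebra (count_space UNIV))"
    by (simp add: space_prob_algebra prob_space_measure_pmf)
  have kernel': "(\<lambda>b. if b then P else Q) \<in> count_space UNIV \<rightarrow>\<^sub>M prob_algebra S"
    using P Q by (auto simp: space_prob_algebra)
  show "prob_space (mixture w P Q)" "sets (mixture w P Q) = sets S"
    unfolding mixture_def using prob_space_bind'[OF pmf kernel'] sets_bind'[OF pmf kernel'] .
  show "emeasure (mixture w P Q) A = ennreal w * emeasure P A + ennreal (1 - w) * emeasure Q A" if "A \<in> sets S"
    unfolding mixture_def using w that
    by (subst emeasure_bind[OF _ measurable_prob_algebraD[OF kernel]]) (auto simp: mult.commute)
qed

text \<open>Given a string, the mixture predicts with the mixture of the two predictions, weighted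
  by the posterior probabilities of the components. This constructs its conditional distributions
  without any regularity of the coordinate spaces.\<close>

lemma mixture_filtered:
  assumes P: "prob_space P" "sets P = sets (seq_space X)" "\<And>l. regular_conditional X P l (kP l)"
    and Q: "prob_space Q" "sets Q = sets (seq_space X)" "\<And>l. regular_conditional X Q l (kQ l)"
  shows "\<exists>k. filtered_prob_space (mixture (1 / 2) P Q) X k"
proof -
  define N where "N = mixture (1 / 2) P Q"
  have N: "prob_space N" "sets N = sets (seq_space X)"
    "\<And>A. A \<in> sets (seq_space X) \<Longrightarrow> emeasure N A = ennreal (1 / 2) * emeasure P A + ennreal (1 / 2) * emeasure Q A"
    unfolding N_def using mixture_properties[OF _ _ P(1,2) Q(1,2), of "1 / 2"] by simp_all
  have "\<exists>k. regular_conditional X N l k" for l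
  proof -
    interpret Nl: prob_space "marginal X l N" by (rule prob_space_marginal[OF N(1,2)])
    have N_marg: "emeasure (marginal X l N) B =
        ennreal (1 / 2) * emeasure (marginal X l P) B + ennreal (1 / 2) * emeasure (marginal X l Q) B"
      if "B \<in> sets (string_space X l)" for B
      using that N P Q by (simp add: emeasure_marginal sets_cylinder)
    have ac: "absolutely_continuous (marginal X l N) (marginal X l P)" "absolutely_continuous (marginal X l N) (marginal X l Q)"
      unfolding absolutely_continuous_def null_sets_def using N_marg by (auto simp: ennreal_zero_less_mult_iff)
    obtain U where "U \<in> borel_measurable (marginal X l N)" and U_P: "density (marginal X l N) U = marginal X l P"
      using Nl.Radon_Nikodym[OF ac(1)] by auto
    then have U [measurable]: "U \<in> borel_measurable (string_space X l)" by simp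
    obtain V where "V \<in> borel_measurable (marginal X l N)" and V_Q: "density (marginal X l N) V = marginal X l Q"
      using Nl.Radon_Nikodym[OF ac(2)] by auto
    then have V [measurable]: "V \<in> borel_measurable (string_space X l)" by simp
    \<comment> \<open>The halves of \<open>U\<close> and \<open>V\<close> are the posterior
      probabilities of \<open>P\<close> and \<open>Q\<close>. Their sum and the constant
      \<open>1\<close> are both densities of \<open>marginal X l N\<close> with respect to
      itself.\<close>
    have UV: "AE x in marginal X l N. ennreal (1 / 2) * U x + ennreal (1 / 2) * V x = 1"
    proof (rule Nl.density_unique2)
      fix B assume "B \<in> sets (marginal X l N)"
      then have B [measurable]: "B \<in> sets (string_space X l)" by simp
      have "(\<integral>\<^sup>+x\<in>B. (ennreal (1 / 2) * U x + ennreal (1 / 2) * V x) \<partial>marginal X l N) =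
          (\<integral>\<^sup>+x. ennreal (1 / 2) * (U x * indicator B x) + ennreal (1 / 2) * (V x * indicator B x) \<partial>marginal X l N)"
        by (intro nn_integral_cong) (simp add: distrib_right mult.assoc)
      also have "\<dots> = ennreal (1 / 2) * emeasure (marginal X l P) B + ennreal (1 / 2) * emeasure (marginal X l Q) B"
        unfolding U_P[symmetric] V_Q[symmetric]
        by (simp add: nn_integral_add nn_integral_cmult emeasure_density)
      finally show "(\<integral>\<^sup>+x\<in>B. (ennreal (1 / 2) * U x + ennreal (1 / 2) * V x) \<partial>marginal X l N) = (\<integral>\<^sup>+x\<in>B. 1 \<partial>marginal X l N)"
        by (simp add: N_marg)
    qed measurable
    \<comment> \<open>Truncation makes \<open>w x\<close> a legitimate weight for every string, as a
      kernel must consist of probability measures everywhere; almost everywhere it is the posterior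
      probability \<open>U x / 2\<close>.\<close>
    define w where "w x = min 1 (enn2real (U x) / 2)" for x
    have w [measurable]: "w \<in> borel_measurable (string_space X l)" and w01: "0 \<le> w x" "w x \<le> 1" for x
      unfolding w_def by simp_all
    have w_UV: "AE x in marginal X l N. ennreal (w x) = ennreal (1 / 2) * U x \<and> ennreal (1 - w x) = ennreal (1 / 2) * V x"
      using UV
    proof eventually_elim
      case (elim x)
      obtain u v where uv: "U x = ennreal u" "0 \<le> u" "V x = ennreal v" "0 \<le> v"
        using elim by (cases "U x"; cases "V x") (auto simp: ennreal_mult_top)
      have half: "ennreal (1 / 2) * U x = ennreal (u / 2)" "ennreal (1 / 2) * V x = ennreal (v / 2)"
        unfolding uv using uv(2,4) by (simp_all add: ennreal_mult[symmetric] del: ennreal_half)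
      then have "ennreal (u / 2 + v / 2) = 1"
        using elim uv unfolding half by (simp add: ennreal_plus)
      then have "u / 2 + v / 2 = 1" by (simp add: ennreal_eq_1)
      then have "w x = u / 2" "1 - w x = v / 2" using uv by (auto simp: w_def)
      then show ?case by (simp only: half)
    qed
    define k where "k x = mixture (w x) (kP l x) (kQ l x)" for x
    have k: "prob_space (k x)" "sets (k x) = sets (seq_space X)"
      "A \<in> sets (seq_space X) \<Longrightarrow> emeasure (k x) A = ennreal (w x) * emeasure (kP l x) A + ennreal (1 - w x) * emeasure (kQ l x) A"
      if "x \<in> space (string_space X l)" for x A
      unfolding k_def
      using mixture_properties[OF w01 regular_conditional_prob_space(1,2)[OF P(3) that] regular_conditional_prob_space(1,2)[OF Q(3) that]]
      by auto
    have "regular_conditional X N l k"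
    proof (rule regular_conditionalI)
      fix A assume A: "A \<in> sets (seq_space X)"
      note [measurable] = regular_conditional_emeasure[OF P(3) A] regular_conditional_emeasure[OF Q(3) A]
      show [measurable]: "(\<lambda>x. emeasure (k x) A) \<in> borel_measurable (string_space X l)"
        by (subst measurable_cong[OF k(3)[OF _ A]]) auto
      fix B assume B [measurable]: "B \<in> sets (string_space X l)"
      have "(\<integral>\<^sup>+x\<in>B. emeasure (k x) A \<partial>marginal X l N) =
        (\<integral>\<^sup>+x. ennreal (1 / 2) * (U x * (emeasure (kP l x) A * indicator B x)) +
             ennreal (1 / 2) * (V x * (emeasure (kQ l x) A * indicator B x)) \<partial>marginal X l N)"
      proof (rule nn_integral_cong_AE)
        show "AE x in marginal X l N. emeasure (k x) A * indicator B x =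
            ennreal (1 / 2) * (U x * (emeasure (kP l x) A * indicator B x)) +
             ennreal (1 / 2) * (V x * (emeasure (kQ l x) A * indicator B x))"
          using w_UV AE_space
        proof eventually_elim
          case (elim x)
          then show ?case using k(3)[OF _ A, of x] by (simp add: distrib_right mult.assoc)
        qed
      qed
      also have "\<dots> = ennreal (1 / 2) * (\<integral>\<^sup>+x\<in>B. emeasure (kP l x) A \<partial>marginal X l P) +
          ennreal (1 / 2) * (\<integral>\<^sup>+x\<in>B. emeasure (kQ l x) A \<partial>marginal X l Q)"
        unfolding U_P[symmetric] V_Q[symmetric]
        by (simp add: nn_integral_add nn_integral_cmult nn_integral_density)
      also have "\<dots> = emeasure N (A \<inter> cylinder X l B)"
        using A B by (subst N(3)) (auto simp: regular_conditional_integral[OF P(3)] regular_conditional_integral[OF Q(3)])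
      finally show "(\<integral>\<^sup>+x\<in>B. emeasure (k x) A \<partial>marginal X l N) = emeasure N (A \<inter> cylinder X l B)" .
    qed (use k in auto)
    then show ?thesis by blast
  qed
  then obtain k where "\<And>l. regular_conditional X N l (k l)" by metis
  then have "filtered_prob_space N X k"
    using N by (intro filtered_prob_space.intro filtered_prob_space_axioms.intro) auto
  then show ?thesis unfolding N_def by blast
qed

text \<open>The even mixture dominates both measures, so Radon-Nikodym supplies the densities, and
  uniqueness forces both given versions to follow Bayes' formula for it.\<close>

lemma unique_imp_consistent_conditionals:
  assumes P: "prob_space P" "sets P = sets (seq_space X)" "\<And>l. regular_conditional X P l (C P l)"
      "\<And>l. as_unique_conditional X P l"
    and Q: "prob_space Q" "sets Q = sets (seq_space X)" "\<And>l. regular_conditional X Q l (C Q l)"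
      "\<And>l. as_unique_conditional X Q l"
  shows "consistent_conditionals X {P, Q} C"
proof -
  define N where "N = mixture (1 / 2) P Q"
  obtain k where "filtered_prob_space N X k"
    unfolding N_def using mixture_filtered[OF P(1,2,3) Q(1,2,3)] by blast
  then interpret filtered_prob_space N X k .
  have N: "A \<in> sets (seq_space X) \<Longrightarrow> emeasure N A = ennreal (1 / 2) * emeasure P A + ennreal (1 / 2) * emeasure Q A" for A
    unfolding N_def using mixture_properties(3)[OF _ _ P(1,2) Q(1,2), of "1 / 2"] by simp
  have "\<exists>f\<in>borel_measurable N. density N f = R" if "R \<in> {P, Q}" for R
  proof (rule Radon_Nikodym)
    show "absolutely_continuous N R"
      unfolding absolutely_continuous_def null_sets_def using that N P(2) Q(2) sets_N
      by (auto simp: ennreal_zero_less_mult_iff)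
    show "sets R = sets N" using that P(2) Q(2) sets_N by auto
  qed
  then obtain f where f: "\<And>R. R \<in> {P, Q} \<Longrightarrow> f R \<in> borel_measurable N" "\<And>R. R \<in> {P, Q} \<Longrightarrow> density N (f R) = R"
    by metis
  have "AE x in marginal X l R. C R l x = density (k l x) (\<lambda>\<omega>. f R \<omega> / (\<integral>\<^sup>+\<omega>'. f R \<omega>' \<partial>k l x))"
    if "R \<in> {P, Q}" for R l
    using that P Q by (intro AE_conditional_of_density f) auto
  then show ?thesis
    unfolding consistent_conditionals_def
    using f sets_N regular prob_space_axioms
    by (intro exI[of _ N] exI[of _ k] exI[of _ f]) (auto simp: borel_N)
qed

subsection \<open>Minimum description length\<close>

text \<open>Unifies the two conventions: point probabilities are densities with respect to counting
  measure on the countable set of strings. Positive length is required because the general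
  convention leaves \<open>q Q 0\<close> unconstrained.\<close>

lemma string_densities_reference:
  assumes q: "string_densities X \<M> q" and l: "0 < l"
    and M: "\<And>Q. Q \<in> \<M> \<Longrightarrow> sets Q = sets (seq_space X)"
  obtains \<mu> where "sets \<mu> = sets (string_space X l)"
    and "\<And>Q. Q \<in> \<M> \<Longrightarrow> q Q l \<in> borel_measurable (string_space X l)"
    and "\<And>Q. Q \<in> \<M> \<Longrightarrow> density \<mu> (q Q l) = marginal X l Q"
proof -
  consider "point_probabilities X \<M> q" | M where "densities_wrt X \<M> M q"
    using q unfolding string_densities_def by blast
  then show ?thesis
  proof cases
    case 1
    define S where "S = space (string_space X l)"
    have X: "countable (space (X t))" "sets (X t) = Pow (space (X t))" for t
      using 1 unfolding point_probabilities_def by blast+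
    have "countable S"
      unfolding S_def space_PiM using X by (intro countable_PiE) auto
    have sets: "sets (string_space X l) = Pow S"
    proof -
      have "sets (string_space X l) = sets (PiM {..<l} (\<lambda>i. count_space (space (X i))))"
        by (intro sets_PiM_cong) (auto simp: X)
      also have "PiM {..<l} (\<lambda>i. count_space (space (X i))) = count_space (PiE {..<l} (\<lambda>i. space (X i)))"
        by (intro count_space_PiM_finite X) auto
      finally show ?thesis by (simp add: S_def space_PiM)
    qed
    show ?thesis
    proof (rule that)
      show "sets (count_space S) = sets (string_space X l)" by (simp add: sets)
      fix Q assume Q: "Q \<in> \<M>"
      show "q Q l \<in> borel_measurable (string_space X l)"
        using measurable_cong_sets[of "string_space X l" "count_space S" borel borel] sets by auto
      show "density (count_space S) (q Q l) = marginal X l Q"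
      proof (rule measure_eqI_countable[where A = S])
        fix x assume x: "x \<in> S"
        have "emeasure (density (count_space S) (q Q l)) {x} = q Q l x"
          using x by (subst emeasure_density) (auto simp: nn_integral_count_space_indicator[symmetric] nn_integral_indicator_finite)
        also have "\<dots> = emeasure Q (cylinder X l {x})"
          using 1 Q x unfolding point_probabilities_def S_def cylinder_def by simp
        also have "\<dots> = emeasure (marginal X l Q) {x}"
          using x by (intro emeasure_marginal[symmetric] M Q) (auto simp: sets)
        finally show "emeasure (density (count_space S) (q Q l)) {x} = emeasure (marginal X l Q) {x}" .
      qed (auto simp: sets \<open>countable S\<close>)
    qed
  next
    case 2
    show ?thesis
      by (rule that[of "marginal X l M"]) (use 2 l in \<open>auto simp: densities_wrt_def\<close>)
  qed
qed

lemma consistent_conditionals_subset: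
  assumes "consistent_conditionals X \<M> C" "\<M>' \<subseteq> \<M>"
  shows "consistent_conditionals X \<M>' C"
proof -
  obtain N k f where *: "prob_space N \<and> sets N = sets (seq_space X) \<and>
      (\<forall>l. regular_conditional X N l (k l)) \<and>
      (\<forall>Q\<in>\<M>. f Q \<in> borel_measurable (seq_space X) \<and> density N (f Q) = Q) \<and>
      (\<forall>Q\<in>\<M>. \<forall>l. AE x in marginal X l Q.
         C Q l x = density (k l x) (\<lambda>\<omega>. f Q \<omega> / (\<integral>\<^sup>+\<omega>'. f Q \<omega>' \<partial>k l x)))"
    using assms(1) unfolding consistent_conditionals_def by (elim exE) (rule that)
  show ?thesis
    unfolding consistent_conditionals_def
    by (rule exI[of _ N], rule exI[of _ k], rule exI[of _ f]) (use * assms(2) in \<open>simp add: subset_iff\<close>)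
qed

text \<open>Exponentiation of the inequality between code lengths. The values
  \<open>\<infinity>\<close> and \<open>- \<infinity>\<close> of \<open>neg_log2\<close> cause no
  exception: an infinite \<open>a\<close> forces an infinite \<open>b\<close>, and
  \<open>b = 0\<close> forces \<open>a = 0\<close>.\<close>

lemma code_length_leD:
  assumes "neg_log2 b + ereal y \<le> neg_log2 a + ereal x"
  shows "ennreal (2 powr (y - x)) * a \<le> b"
proof (cases "a = 0 \<or> b = \<top>")
  case True then show ?thesis by auto
next
  case False
  then have "a \<noteq> \<top>"
    using assms by (auto simp: neg_log2_def split: if_splits)
  with False obtain r where r: "a = ennreal r" "0 < r"
    by (cases a) (auto simp: less_le)
  have "b \<noteq> 0"
    using assms False \<open>a \<noteq> \<top>\<close> by (auto simp: neg_log2_def)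
  with False obtain s where s: "b = ennreal s" "0 < s"
    by (cases b) (auto simp: less_le)
  have "- log 2 s + y \<le> - log 2 r + x"
    using assms r s by (simp add: neg_log2_def)
  then have "(y - x) + log 2 r \<le> log 2 s" by simp
  then have "2 powr ((y - x) + log 2 r) \<le> 2 powr (log 2 s)"
    by (intro powr_mono) auto
  then have "2 powr (y - x) * r \<le> s"
    using r s by (simp add: powr_add)
  then show ?thesis
    using r s by (simp add: ennreal_mult[symmetric] ennreal_leI)
qed

text \<open>An infinite index set is enumerated bijectively, so that summability over the set
  becomes summability of a series, and a bound on the positions that occur leaves only finitely many
  indices.\<close>

lemma AE_finite_Borel_Cantelli:
  assumes "countable I" and "prob_space P"
    and A: "\<And>i. i \<in> I \<Longrightarrow> A i \<in> sets P"
    and le: "\<And>i. i \<in> I \<Longrightarrow> measure P (A i) \<le> b i" and b: "b summable_on I"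
  shows "AE \<omega> in P. finite {i\<in>I. \<omega> \<in> A i}"
proof (cases "finite I")
  case False
  interpret prob_space P by fact
  define e where "e = from_nat_into I"
  have e: "bij_betw e UNIV I"
    unfolding e_def using \<open>countable I\<close> False by (rule bij_betw_from_nat_into)
  then have e_in: "e n \<in> I" for n by (auto simp: bij_betw_def)
  have b_nonneg: "0 \<le> b (e n)" for n
    using order_trans[OF measure_nonneg le[OF e_in]] .
  have "(\<lambda>n. b (e n)) summable_on UNIV"
    using b summable_on_reindex_bij_betw[OF e, of b] by simp
  then have "summable (\<lambda>n. b (e n))"
    using b_nonneg by (simp add: summable_on_UNIV_nonneg_real_iff)
  then have "summable (\<lambda>n. prob (A (e n)))"
    by (rule summable_comparison_test[rotated]) (use le[OF e_in] in auto)
  then have "AE \<omega> in P. \<forall>\<^sub>F n in sequentially. \<omega> \<in> space P - A (e n)"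
    using A[OF e_in] by (intro borel_cantelli_AE1) (auto simp: emeasure_eq_measure)
  then show ?thesis
  proof eventually_elim
    case (elim \<omega>)
    then obtain m where m: "\<And>n. m \<le> n \<Longrightarrow> \<omega> \<notin> A (e n)"
      by (auto simp: eventually_sequentially)
    have "{i\<in>I. \<omega> \<in> A i} \<subseteq> e ` {..<m}"
    proof
      fix i assume i: "i \<in> {i\<in>I. \<omega> \<in> A i}"
      then obtain n where n: "i = e n" using e by (auto simp: bij_betw_def)
      then have "n < m" using m[of n] i by (auto simp: not_le[symmetric])
      then show "i \<in> e ` {..<m}" using n by blast
    qed
    then show ?case using finite_surj by blast
  qed
qed auto

theorem theorem1:
  fixes X :: "nat \<Rightarrow> 'a measure"
    and \<M> :: "(nat \<Rightarrow> 'a) measure set"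
    and P :: "(nat \<Rightarrow> 'a) measure"
    and K :: "(nat \<Rightarrow> 'a) measure \<Rightarrow> real"
    and q :: "(nat \<Rightarrow> 'a) measure \<Rightarrow> nat \<Rightarrow> (nat \<Rightarrow> 'a) \<Rightarrow> ennreal"
    and C :: "(nat \<Rightarrow> 'a) measure \<Rightarrow> nat \<Rightarrow> (nat \<Rightarrow> 'a) \<Rightarrow> (nat \<Rightarrow> 'a) measure"
    and MDL :: "nat \<Rightarrow> (nat \<Rightarrow> 'a) \<Rightarrow> (nat \<Rightarrow> 'a) measure"
  assumes "countable \<M>"
    and "\<And>Q. Q \<in> \<M> \<Longrightarrow> prob_space Q \<and> sets Q = sets (seq_space X)"
    and "P \<in> \<M>"
    and "(\<lambda>Q. 2 powr (- K Q)) summable_on \<M>"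
    and "string_densities X \<M> q"
    and "predictive_distributions X \<M> C"
    and "MDL_selector X \<M> q K MDL"
  shows "AE \<omega> in P.
    (\<lambda>l. SUP A\<in>sets (seq_space X).
       \<bar>measure (C (MDL l (initial l \<omega>)) l (initial l \<omega>)) A - measure (C P l (initial l \<omega>)) A\<bar>)
    \<longlonglongrightarrow> 0"
proof -
  have prob: "prob_space Q" and sets: "sets Q = sets (seq_space X)" if "Q \<in> \<M>" for Q
    using assms(2) that by auto
  interpret P: prob_space P by (rule prob[OF \<open>P \<in> \<M>\<close>])
  have space_P: "space P = space (seq_space X)"
    using sets[OF \<open>P \<in> \<M>\<close>] by (rule sets_eq_imp_space_eq)
  \<comment> \<open>The threshold obtained by solving
    \<open>code_length q K l x Q \<le> code_length q K l x P\<close> for the ratio of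
    \<open>q Q l x\<close> to \<open>q P l x\<close>.\<close>
  define c where "c Q = ennreal (2 powr (K Q - K P))" for Q
  \<comment> \<open>At \<open>l = 0\<close> the values of \<open>q\<close> need not be densities.\<close>
  define E where "E Q l = (if l = 0 then {} else {x\<in>space (string_space X l). c Q * q P l x \<le> q Q l x})" for Q l
  have c: "0 < c Q" "c Q < \<top>" for Q by (simp_all add: c_def)
  have q_meas: "q Q l \<in> borel_measurable (string_space X l)" if "Q \<in> \<M>" "0 < l" for Q l
    using string_densities_reference[OF assms(5) \<open>0 < l\<close> sets] that(1) by metis
  have E: "E Q l \<in> sets (string_space X l)" if "Q \<in> \<M>" for Q l
  proof (cases "l = 0")
    case False
    then have [measurable]: "q Q l \<in> borel_measurable (string_space X l)" "q P l \<in> borel_measurable (string_space X l)"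
      using q_meas that \<open>P \<in> \<M>\<close> by auto
    have "{x\<in>space (string_space X l). c Q * q P l x \<le> q Q l x} \<in> sets (string_space X l)" by measurable
    then show ?thesis using False by (simp add: E_def)
  qed (simp add: E_def)
  \<comment> \<open>Integrating the pointwise inequality that defines \<open>E Q l\<close> over
    \<open>D\<close> eliminates the reference measure.\<close>
  have dom: "c Q * emeasure P (cylinder X l D) \<le> emeasure Q (cylinder X l D)"
    if Q: "Q \<in> \<M>" and D: "D \<in> sets (string_space X l)" "D \<subseteq> E Q l" for Q l D
  proof (cases "l = 0")
    case True
    then show ?thesis using D(2) by (simp add: E_def cylinder_def)
  next
    case False
    then obtain \<mu> where \<mu>: "sets \<mu> = sets (string_space X l)"
      "\<And>Q. Q \<in> \<M> \<Longrightarrow> q Q l \<in> borel_measurable (string_space X l)"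
      "\<And>Q. Q \<in> \<M> \<Longrightarrow> density \<mu> (q Q l) = marginal X l Q"
      using string_densities_reference[OF assms(5) _ sets] by blast
    have [measurable]: "R \<in> \<M> \<Longrightarrow> q R l \<in> borel_measurable \<mu>" for R
      using \<mu>(2)[of R] measurable_cong_sets[OF \<mu>(1) refl, of borel] by blast
    have [measurable]: "D \<in> sets \<mu>" using D \<mu>(1) by simp
    have em: "emeasure R (cylinder X l D) = (\<integral>\<^sup>+x\<in>D. q R l x \<partial>\<mu>)" if R: "R \<in> \<M>" for R
      using R by (simp add: emeasure_marginal[OF sets[OF R] D(1), symmetric] \<mu>(3)[OF R, symmetric] emeasure_density)
    have "c Q * (\<integral>\<^sup>+x\<in>D. q P l x \<partial>\<mu>) = (\<integral>\<^sup>+x\<in>D. c Q * q P l x \<partial>\<mu>)"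
      using \<open>P \<in> \<M>\<close> by (subst nn_integral_cmult[symmetric]) (auto simp: mult.assoc)
    also have "\<dots> \<le> (\<integral>\<^sup>+x\<in>D. q Q l x \<partial>\<mu>)"
      using D(2) False by (intro nn_integral_mono) (auto simp: E_def indicator_def)
    finally show ?thesis using em Q \<open>P \<in> \<M>\<close> by simp
  qed

  \<comment> \<open>Ville's bound for \<open>Q\<close> is \<open>1 / c Q\<close>, that is
    \<open>2 powr K P * 2 powr (- K Q)\<close>; its summability over the class is precisely the
    hypothesis on \<open>K\<close>.\<close>
  have "AE \<omega> in P. finite {Q\<in>\<M>. \<omega> \<in> (\<Union>l. cylinder X l (E Q l))}"
  proof (rule AE_finite_Borel_Cantelli[OF assms(1) prob[OF \<open>P \<in> \<M>\<close>]])
    fix Q assume Q: "Q \<in> \<M>"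
    show "(\<Union>l. cylinder X l (E Q l)) \<in> sets P"
      using sets_cylinder[OF E[OF Q]] sets[OF \<open>P \<in> \<M>\<close>] by auto
    have "c Q * emeasure P (\<Union>l. cylinder X l (E Q l)) \<le> emeasure Q (space Q)"
      by (rule maximal_inequality[OF sets[OF \<open>P \<in> \<M>\<close>] sets[OF Q] E[OF Q] dom[OF Q]])
    then have "ennreal (2 powr (K Q - K P) * P.prob (\<Union>l. cylinder X l (E Q l))) \<le> 1"
      unfolding c_def prob_space.emeasure_space_1[OF prob[OF Q]] by (simp add: P.emeasure_eq_measure ennreal_mult)
    then have "2 powr (K Q - K P) * P.prob (\<Union>l. cylinder X l (E Q l)) \<le> 1"
      by (simp add: ennreal_le_1)
    then show "P.prob (\<Union>l. cylinder X l (E Q l)) \<le> 2 powr K P * 2 powr (- K Q)"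
      by (simp add: powr_diff powr_minus field_simps)
  qed (intro summable_on_cmult_right assms(4))
  moreover have "AE \<omega> in P. \<forall>l. 0 < l \<longrightarrow> q P l (initial l \<omega>) \<noteq> 0"
  proof (intro AE_all_countable[THEN iffD2] allI)
    fix l
    show "AE \<omega> in P. 0 < l \<longrightarrow> q P l (initial l \<omega>) \<noteq> 0"
    proof (cases "l = 0")
      case False
      then obtain \<mu> where \<mu>: "sets \<mu> = sets (string_space X l)"
        "q P l \<in> borel_measurable (string_space X l)" "density \<mu> (q P l) = marginal X l P"
        using string_densities_reference[OF assms(5) _ sets] \<open>P \<in> \<M>\<close> by (metis gr0I)
      have "q P l \<in> borel_measurable \<mu>"
        using \<mu>(2) measurable_cong_sets[OF \<mu>(1) refl, of borel] by blast
      then have "AE x in density \<mu> (q P l). q P l x \<noteq> 0"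
        by (subst AE_density) (auto intro: AE_I2)
      then have "AE x in marginal X l P. q P l x \<noteq> 0" unfolding \<mu>(3) .
      from AE_marginalD[OF sets[OF \<open>P \<in> \<M>\<close>] this] show ?thesis by simp
    qed simp
  qed
  \<comment> \<open>The null set, and in the case of unique versions also the dominating measure,
    depends on \<open>Q\<close>; countability of the class allows the quantifier inside.\<close>
  moreover have "AE \<omega> in P. \<forall>Q\<in>\<M>. (\<exists>\<^sub>F l in sequentially. initial l \<omega> \<in> E Q l) \<longrightarrow>
    (\<forall>\<epsilon>>0. \<forall>\<^sub>F l in sequentially. \<forall>A\<in>sets (seq_space X).
      \<bar>measure (C Q l (initial l \<omega>)) A - measure (C P l (initial l \<omega>)) A\<bar> \<le> \<epsilon>)"
  proof (intro AE_ball_countable[OF assms(1), THEN iffD2] ballI)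
    fix Q assume Q: "Q \<in> \<M>"
    have C: "R \<in> \<M> \<Longrightarrow> regular_conditional X R l (C R l)" for R l
      using assms(6) by (simp add: predictive_distributions_def)
    have "(\<forall>Q\<in>\<M>. \<forall>l. as_unique_conditional X Q l) \<or> consistent_conditionals X \<M> C"
      using assms(6) by (simp add: predictive_distributions_def)
    then have "consistent_conditionals X {P, Q} C"
    proof
      assume "\<forall>Q\<in>\<M>. \<forall>l. as_unique_conditional X Q l"
      then show ?thesis
        using Q \<open>P \<in> \<M>\<close> by (intro unique_imp_consistent_conditionals prob sets C) auto
    next
      assume cons: "consistent_conditionals X \<M> C"
      have "{P, Q} \<subseteq> \<M>" using Q \<open>P \<in> \<M>\<close> by simp
      then show ?thesis
        by (rule consistent_conditionals_subset[OF cons])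
    qed
    then show "AE \<omega> in P. (\<exists>\<^sub>F l in sequentially. initial l \<omega> \<in> E Q l) \<longrightarrow>
      (\<forall>\<epsilon>>0. \<forall>\<^sub>F l in sequentially. \<forall>A\<in>sets (seq_space X).
        \<bar>measure (C Q l (initial l \<omega>)) A - measure (C P l (initial l \<omega>)) A\<bar> \<le> \<epsilon>)"
      by (rule predictive_merging[OF _ prob[OF \<open>P \<in> \<M>\<close>] sets[OF \<open>P \<in> \<M>\<close>] prob[OF Q] sets[OF Q] c E[OF Q] dom[OF Q]])
  qed
  ultimately show ?thesis
    using AE_space
  proof eventually_elim
    case (elim \<omega>)
    define F where "F = {Q\<in>\<M>. \<omega> \<in> (\<Union>l. cylinder X l (E Q l))}"
    have "finite F" using elim(1) by (simp add: F_def)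
    have selected: "MDL l (initial l \<omega>) \<in> F \<and> initial l \<omega> \<in> E (MDL l (initial l \<omega>)) l" if l: "0 < l" for l
    proof -
      let ?x = "initial l \<omega>" and ?L = "code_length q K l (initial l \<omega>)"
      have x: "?x \<in> space (string_space X l)" using elim(4) by (simp add: space_P initial_in_space)
      have beats: "Q \<in> F \<and> ?x \<in> E Q l" if "Q \<in> \<M>" "?L Q \<le> ?L P" for Q
      proof -
        have "?x \<in> E Q l"
          using code_length_leD[of "q Q l ?x" "K Q" "q P l ?x" "K P"] that(2) x l
          by (simp add: E_def c_def code_length_def)
        then show ?thesis
          using that(1) elim(4) by (auto simp: F_def cylinder_def space_P)
      qed
      \<comment> \<open>Since \<open>P\<close> ties with itself, \<open>F\<close> is nonempty and
        has a minimiser. Any model of the class that is strictly better would also be at least as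
        good as \<open>P\<close>, hence lie in \<open>F\<close>; so the minimum over the whole class
        is attained and the selector is bound to it.\<close>
      have "P \<in> F" using beats[OF \<open>P \<in> \<M>\<close>] by simp
      then obtain Q where Q: "is_arg_min ?L (\<lambda>Q. Q \<in> F) Q"
        using ex_is_arg_min_if_finite[OF \<open>finite F\<close>] by blast
      have "is_arg_min ?L (\<lambda>Q. Q \<in> \<M>) Q"
        unfolding is_arg_min_def
      proof (intro conjI notI)
        show "Q \<in> \<M>" using Q by (auto simp: is_arg_min_def F_def)
        assume "\<exists>R. R \<in> \<M> \<and> ?L R < ?L Q"
        then obtain R where R: "R \<in> \<M>" "?L R < ?L Q" by blast
        have "?L Q \<le> ?L P" using Q \<open>P \<in> F\<close> by (auto simp: is_arg_min_linorder)
        then have "R \<in> F" using beats[of R] R by simp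
        then show False using Q R(2) by (auto simp: is_arg_min_def)
      qed
      then have "is_arg_min ?L (\<lambda>Q. Q \<in> \<M>) (MDL l ?x)"
        using assms(7) x unfolding MDL_selector_def by blast
      then show ?thesis
        using \<open>P \<in> \<M>\<close> by (intro beats) (auto simp: is_arg_min_linorder)
    qed
    show ?case
    proof (rule tendstoI)
      fix \<epsilon> :: real assume "0 < \<epsilon>"
      have "\<forall>\<^sub>F l in sequentially. \<forall>Q\<in>F. initial l \<omega> \<in> E Q l \<longrightarrow> (\<forall>A\<in>sets (seq_space X).
          \<bar>measure (C Q l (initial l \<omega>)) A - measure (C P l (initial l \<omega>)) A\<bar> \<le> \<epsilon> / 2)"
      \<comment> \<open>Finiteness of \<open>F\<close> makes one length serve all candidates,
        although the selected model may keep changing. A candidate that beats \<open>P\<close> only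
        finitely often satisfies the implication vacuously from some length on.\<close>
      proof (rule eventually_ball_finite[OF \<open>finite F\<close>], rule ballI)
        fix Q assume "Q \<in> F"
        show "\<forall>\<^sub>F l in sequentially. initial l \<omega> \<in> E Q l \<longrightarrow> (\<forall>A\<in>sets (seq_space X).
            \<bar>measure (C Q l (initial l \<omega>)) A - measure (C P l (initial l \<omega>)) A\<bar> \<le> \<epsilon> / 2)"
        proof (cases "\<exists>\<^sub>F l in sequentially. initial l \<omega> \<in> E Q l")
          case True
          have "Q \<in> \<M>" using \<open>Q \<in> F\<close> by (simp add: F_def)
          then have "\<forall>\<^sub>F l in sequentially. \<forall>A\<in>sets (seq_space X).
              \<bar>measure (C Q l (initial l \<omega>)) A - measure (C P l (initial l \<omega>)) A\<bar> \<le> \<epsilon> / 2"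
            using elim(3) True half_gt_zero[OF \<open>0 < \<epsilon>\<close>] by blast
          then show ?thesis by eventually_elim blast
        next
          case False
          then show ?thesis unfolding not_frequently by eventually_elim blast
        qed
      qed
      then show "\<forall>\<^sub>F l in sequentially. dist (SUP A\<in>sets (seq_space X).
          \<bar>measure (C (MDL l (initial l \<omega>)) l (initial l \<omega>)) A - measure (C P l (initial l \<omega>)) A\<bar>) 0 < \<epsilon>"
        using eventually_gt_at_top[of 0]
      proof eventually_elim
        fix l :: nat
        assume close: "\<forall>Q\<in>F. initial l \<omega> \<in> E Q l \<longrightarrow> (\<forall>A\<in>sets (seq_space X).
            \<bar>measure (C Q l (initial l \<omega>)) A - measure (C P l (initial l \<omega>)) A\<bar> \<le> \<epsilon> / 2)" and "0 < l"
        define d where "d A = \<bar>measure (C (MDL l (initial l \<omega>)) l (initial l \<omega>)) A - measure (C P l (initial l \<omega>)) A\<bar>" for A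
        have d: "d A \<le> \<epsilon> / 2" if "A \<in> sets (seq_space X)" for A
          unfolding d_def using close selected[OF \<open>0 < l\<close>] that by blast
        have "(SUP A\<in>sets (seq_space X). d A) \<le> \<epsilon> / 2"
          using d by (intro cSUP_least) auto
        \<comment> \<open>The distance to \<open>0\<close> is an absolute value, so the supremum
          must also be bounded below; the empty event contributes the value
          \<open>0\<close>.\<close>
        moreover have "d {} \<le> (SUP A\<in>sets (seq_space X). d A)"
          by (rule cSUP_upper) (auto intro!: bdd_aboveI2 d)
        ultimately show "dist (SUP A\<in>sets (seq_space X).
          \<bar>measure (C (MDL l (initial l \<omega>)) l (initial l \<omega>)) A - measure (C P l (initial l \<omega>)) A\<bar>) 0 < \<epsilon>"
          using \<open>0 < \<epsilon>\<close> unfolding d_def dist_real_def by simp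
      qed
    qed
  qed
qed

end
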